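(* Let $A$ be a local ring (i.e. $A/\mathfrak{r}$ is a division ring), not necessarily commutative, with Jacobson radical $\mathfrak{r}$. Suppose $A$ is finite and has an involution $*$ whose set of fixed points, say $R$, lies in the center of $A$. Let $\mathfrak{m}$ be the Jacobson radical of the finite local commutative ring $R$ and suppose that the residue field $R/\mathfrak{m}\cong F_q$ has odd characteristic. Let $\mathfrak{s}$ be the kernel of the trace map $\mathfrak{r}\to\mathfrak{m}$, $a\mapsto a+a^*$. Let $V$ be a free right $A$-module of rank $m\geq 1$ equipped with a non-degenerate $*$-hermitian form $h$. Let $U_m(A)$ and $U_m(\overline{A})$ be the unitary groups associated to $(V,h)$ and to its reduction $(\overline{V},\overline{h})$ modulo $\mathfrak{r}$. Then $$|U_m(A)|=|\mathfrak{r}|^{m(m-1)/2}\,|\mathfrak{s}|^m\, |U_m(\overline{A})|=|\mathfrak{r}|^{m(m+1)/2}\, |U_m(\overline{A})|/|\mathfrak{m}|^m.$$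
   Context: An involution $*$ of a ring $A$ (with identity) is an anti-automorphism of order at most $2$ (the identity is allowed if $A$ is commutative). A $*$-hermitian form on a right $A$-module $V$ is a biadditive map $h:V\times V\to A$ that is $A$-linear in the second variable, $h(u,va)=h(u,v)a$, and satisfies $h(v,u)=h(u,v)^*$. The dual $V^*=\mathrm{Hom}_A(V,A)$ is a right $A$-module via $(\alpha a)(v)=a^*\alpha(v)$; $h$ is non-degenerate if $u\mapsto h(u,-)$ is an isomorphism $V\to V^*$. The unitary group of $(V,h)$ is the group of all $A$-linear automorphisms $g$ of $V$ with $h(gv,gw)=h(v,w)$ for all $v,w\in V$. Reduction modulo $\mathfrak{r}$: $\overline{A}=A/\mathfrak{r}$ with the involution induced by $*$, $\overline{V}=V/V\mathfrak{r}$, which is free of rank $m$ over $\overline{A}$, and $\overline{h}(v+V\mathfrak{r},w+V\mathfrak{r})=h(v,w)+\mathfrak{r}$, which is a non-degenerate hermitian form. *)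

theory Defs
  imports "HOL-Algebra.QuotRing" "HOL-Algebra.Bij" "HOL-Algebra.Generated_Groups"
    "HOL-Algebra.Multiplicative_Group"
begin

section \<open>Rings with involution\<close>

locale right_ideal = additive_subgroup I A + ring A for I and A (structure) +
  assumes I_r_closed: "x \<in> I \<Longrightarrow> a \<in> carrier A \<Longrightarrow> x \<otimes> a \<in> I"

definition maximal_right_ideal :: "'a set \<Rightarrow> ('a, 'r) ring_scheme \<Rightarrow> bool" where
  "maximal_right_ideal I A \<longleftrightarrow> right_ideal I A \<and> I \<noteq> carrier A \<and>
     (\<forall>J. right_ideal J A \<and> I \<subseteq> J \<longrightarrow> J = I \<or> J = carrier A)"

definition jacobson_radical :: "('a, 'r) ring_scheme \<Rightarrow> 'a set" where
  "jacobson_radical A = carrier A \<inter> \<Inter>{I. maximal_right_ideal I A}"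

definition division_ring :: "('a, 'r) ring_scheme \<Rightarrow> bool" where
  "division_ring D \<longleftrightarrow> ring D \<and> \<one>\<^bsub>D\<^esub> \<noteq> \<zero>\<^bsub>D\<^esub> \<and> Units D = carrier D - {\<zero>\<^bsub>D\<^esub>}"

definition local_ring :: "('a, 'r) ring_scheme \<Rightarrow> bool" where
  "local_ring A \<longleftrightarrow> ring A \<and> division_ring (A Quot jacobson_radical A)"

definition ring_characteristic :: "('a, 'r) ring_scheme \<Rightarrow> nat" where
  "ring_characteristic K = group.ord (add_monoid K) \<one>\<^bsub>K\<^esub>"

definition opposite_ring :: "('a, 'r) ring_scheme \<Rightarrow> ('a, 'r) ring_scheme" where
  "opposite_ring A = A\<lparr>monoid.mult := \<lambda>x y. y \<otimes>\<^bsub>A\<^esub> x\<rparr>"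

definition ring_involution :: "('a, 'r) ring_scheme \<Rightarrow> ('a \<Rightarrow> 'a) \<Rightarrow> bool" where
  "ring_involution A star \<longleftrightarrow>
     star \<in> ring_iso A (opposite_ring A) \<and> (\<forall>a\<in>carrier A. star (star a) = a)"

definition ring_center :: "('a, 'r) ring_scheme \<Rightarrow> 'a set" where
  "ring_center A = {z \<in> carrier A. \<forall>a\<in>carrier A. z \<otimes>\<^bsub>A\<^esub> a = a \<otimes>\<^bsub>A\<^esub> z}"

definition fixed_points :: "('a, 'r) ring_scheme \<Rightarrow> ('a \<Rightarrow> 'a) \<Rightarrow> 'a set" where
  "fixed_points A star = {a \<in> carrier A. star a = a}"

definition fixed_ring :: "('a, 'r) ring_scheme \<Rightarrow> ('a \<Rightarrow> 'a) \<Rightarrow> ('a, 'r) ring_scheme" where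
  "fixed_ring A star = A\<lparr>carrier := fixed_points A star\<rparr>"

definition trace_kernel :: "('a, 'r) ring_scheme \<Rightarrow> ('a \<Rightarrow> 'a) \<Rightarrow> 'a set" where
  "trace_kernel A star =
     a_kernel (A\<lparr>carrier := jacobson_radical A\<rparr>)
       (A\<lparr>carrier := jacobson_radical (fixed_ring A star)\<rparr>)
       (\<lambda>a. a \<oplus>\<^bsub>A\<^esub> star a)"


section \<open>Right modules\<close>

text \<open>As for the record of modules in the library, the fields \<open>mult\<close> and \<open>one\<close> inherited from
  \<open>ring\<close> carry no meaning.\<close>

record ('a, 'v) rmodule = "'v ring" +
  rsmult :: "'v \<Rightarrow> 'a \<Rightarrow> 'v" (infixl \<open>\<odot>\<^sub>r\<index>\<close> 70)

locale right_module = A?: ring A + V?: abelian_group V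
  for A :: "('a, 'r) ring_scheme" (structure) and V :: "('a, 'v, 's) rmodule_scheme" (structure) +
  assumes rsmult_closed [simp, intro]:
      "\<lbrakk>v \<in> carrier V; a \<in> carrier A\<rbrakk> \<Longrightarrow> v \<odot>\<^sub>r\<^bsub>V\<^esub> a \<in> carrier V"
    and rsmult_l_distr:
      "\<lbrakk>v \<in> carrier V; w \<in> carrier V; a \<in> carrier A\<rbrakk> \<Longrightarrow>
        (v \<oplus>\<^bsub>V\<^esub> w) \<odot>\<^sub>r\<^bsub>V\<^esub> a = v \<odot>\<^sub>r\<^bsub>V\<^esub> a \<oplus>\<^bsub>V\<^esub> w \<odot>\<^sub>r\<^bsub>V\<^esub> a"
    and rsmult_r_distr:
      "\<lbrakk>v \<in> carrier V; a \<in> carrier A; b \<in> carrier A\<rbrakk> \<Longrightarrow>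
        v \<odot>\<^sub>r\<^bsub>V\<^esub> (a \<oplus>\<^bsub>A\<^esub> b) = v \<odot>\<^sub>r\<^bsub>V\<^esub> a \<oplus>\<^bsub>V\<^esub> v \<odot>\<^sub>r\<^bsub>V\<^esub> b"
    and rsmult_assoc:
      "\<lbrakk>v \<in> carrier V; a \<in> carrier A; b \<in> carrier A\<rbrakk> \<Longrightarrow>
        v \<odot>\<^sub>r\<^bsub>V\<^esub> (a \<otimes>\<^bsub>A\<^esub> b) = (v \<odot>\<^sub>r\<^bsub>V\<^esub> a) \<odot>\<^sub>r\<^bsub>V\<^esub> b"
    and rsmult_one [simp]: "v \<in> carrier V \<Longrightarrow> v \<odot>\<^sub>r\<^bsub>V\<^esub> \<one>\<^bsub>A\<^esub> = v"

definition free_of_rank ::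
    "('a, 'r) ring_scheme \<Rightarrow> ('a, 'v, 's) rmodule_scheme \<Rightarrow> nat \<Rightarrow> bool" where
  "free_of_rank A V m \<longleftrightarrow> (\<exists>e \<in> {..<m} \<rightarrow> carrier V. \<forall>v\<in>carrier V.
     \<exists>!c. c \<in> {..<m} \<rightarrow>\<^sub>E carrier A \<and> v = finsum V (\<lambda>i. e i \<odot>\<^sub>r\<^bsub>V\<^esub> c i) {..<m})"

definition rmodule_hom ::
    "('a, 'r) ring_scheme \<Rightarrow> ('a, 'v, 's) rmodule_scheme \<Rightarrow> ('a, 'w, 't) rmodule_scheme
      \<Rightarrow> ('v \<Rightarrow> 'w) set" where
  "rmodule_hom A V W = {f \<in> carrier V \<rightarrow> carrier W.
     (\<forall>v\<in>carrier V. \<forall>w\<in>carrier V. f (v \<oplus>\<^bsub>V\<^esub> w) = f v \<oplus>\<^bsub>W\<^esub> f w) \<and>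
     (\<forall>v\<in>carrier V. \<forall>a\<in>carrier A. f (v \<odot>\<^sub>r\<^bsub>V\<^esub> a) = f v \<odot>\<^sub>r\<^bsub>W\<^esub> a)}"

definition rmodule_iso ::
    "('a, 'r) ring_scheme \<Rightarrow> ('a, 'v, 's) rmodule_scheme \<Rightarrow> ('a, 'w, 't) rmodule_scheme
      \<Rightarrow> ('v \<Rightarrow> 'w) set" where
  "rmodule_iso A V W = {f \<in> rmodule_hom A V W. bij_betw f (carrier V) (carrier W)}"

definition regular_rmodule :: "('a, 'r) ring_scheme \<Rightarrow> ('a, 'a) rmodule" where
  "regular_rmodule A = \<lparr>carrier = carrier A, monoid.mult = monoid.mult A, one = \<one>\<^bsub>A\<^esub>,
     ring.zero = \<zero>\<^bsub>A\<^esub>, add = add A, rsmult = monoid.mult A\<rparr>"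

text \<open>Functionals are represented by functions that are \<open>undefined\<close> outside \<open>carrier V\<close>, so that
  equal functionals are equal as HOL functions.\<close>

definition dual_rmodule ::
    "('a, 'r) ring_scheme \<Rightarrow> ('a \<Rightarrow> 'a) \<Rightarrow> ('a, 'v, 's) rmodule_scheme
      \<Rightarrow> ('a, 'v \<Rightarrow> 'a) rmodule" where
  "dual_rmodule A star V =
     \<lparr>carrier = rmodule_hom A V (regular_rmodule A) \<inter> extensional (carrier V),
      monoid.mult = undefined, one = undefined,
      ring.zero = (\<lambda>v\<in>carrier V. \<zero>\<^bsub>A\<^esub>),
      add = (\<lambda>\<alpha> \<beta>. \<lambda>v\<in>carrier V. \<alpha> v \<oplus>\<^bsub>A\<^esub> \<beta> v),
      rsmult = (\<lambda>\<alpha> a. \<lambda>v\<in>carrier V. star a \<otimes>\<^bsub>A\<^esub> \<alpha> v)\<rparr>"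


section \<open>Hermitian forms and unitary groups\<close>

definition hermitian_form ::
    "('a, 'r) ring_scheme \<Rightarrow> ('a \<Rightarrow> 'a) \<Rightarrow> ('a, 'v, 's) rmodule_scheme
      \<Rightarrow> ('v \<Rightarrow> 'v \<Rightarrow> 'a) \<Rightarrow> bool" where
  "hermitian_form A star V h \<longleftrightarrow>
     h \<in> carrier V \<rightarrow> carrier V \<rightarrow> carrier A \<and>
     (\<forall>u\<in>carrier V. \<forall>v\<in>carrier V. \<forall>w\<in>carrier V.
        h (u \<oplus>\<^bsub>V\<^esub> v) w = h u w \<oplus>\<^bsub>A\<^esub> h v w \<and>
        h u (v \<oplus>\<^bsub>V\<^esub> w) = h u v \<oplus>\<^bsub>A\<^esub> h u w) \<and>
     (\<forall>u\<in>carrier V. \<forall>v\<in>carrier V. \<forall>a\<in>carrier A. h u (v \<odot>\<^sub>r\<^bsub>V\<^esub> a) = h u v \<otimes>\<^bsub>A\<^esub> a) \<and>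
     (\<forall>u\<in>carrier V. \<forall>v\<in>carrier V. h v u = star (h u v))"

definition nondegenerate ::
    "('a, 'r) ring_scheme \<Rightarrow> ('a \<Rightarrow> 'a) \<Rightarrow> ('a, 'v, 's) rmodule_scheme
      \<Rightarrow> ('v \<Rightarrow> 'v \<Rightarrow> 'a) \<Rightarrow> bool" where
  "nondegenerate A star V h \<longleftrightarrow>
     (\<lambda>u. \<lambda>v\<in>carrier V. h u v) \<in> rmodule_iso A V (dual_rmodule A star V)"

definition unitary_group ::
    "('a, 'r) ring_scheme \<Rightarrow> ('a, 'v, 's) rmodule_scheme \<Rightarrow> ('v \<Rightarrow> 'v \<Rightarrow> 'a)
      \<Rightarrow> ('v \<Rightarrow> 'v) monoid" where
  "unitary_group A V h = BijGroup (carrier V)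
     \<lparr>carrier := {g \<in> Bij (carrier V). g \<in> rmodule_iso A V V \<and>
        (\<forall>v\<in>carrier V. \<forall>w\<in>carrier V. h (g v) (g w) = h v w)}\<rparr>"


section \<open>Reduction modulo an ideal\<close>

text \<open>The submodule \<open>V I\<close> of finite sums of products \<open>v a\<close> with \<open>a \<in> I\<close>.\<close>

definition ideal_multiple :: "('a, 'v, 's) rmodule_scheme \<Rightarrow> 'a set \<Rightarrow> 'v set" where
  "ideal_multiple V I = generate (add_monoid V) {v \<odot>\<^sub>r\<^bsub>V\<^esub> a | v a. v \<in> carrier V \<and> a \<in> I}"

text \<open>The operations on \<open>V/VI\<close> and the form on it are given by unions over all representatives,
  in the style of \<open>rcoset_mult\<close>; for a well-defined operation all members of such a union
  coincide (see \<open>reduced_smult_coset\<close> and \<open>reduced_form_coset\<close> below). The scalars of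
  \<open>reduced_rmodule V I\<close> are the elements of \<open>A Quot I\<close>, that is, cosets of \<open>I\<close>.\<close>

definition reduced_rmodule ::
    "('a, 'v, 's) rmodule_scheme \<Rightarrow> 'a set \<Rightarrow> ('a set, 'v set) rmodule" where
  "reduced_rmodule V I =
     \<lparr>carrier = a_rcosets\<^bsub>V\<^esub> (ideal_multiple V I), monoid.mult = undefined, one = undefined,
      ring.zero = ideal_multiple V I, add = set_add V,
      rsmult = (\<lambda>C D. \<Union>v\<in>C. \<Union>a\<in>D. ideal_multiple V I +>\<^bsub>V\<^esub> (v \<odot>\<^sub>r\<^bsub>V\<^esub> a))\<rparr>"

definition reduced_form ::
    "('a, 'r) ring_scheme \<Rightarrow> 'a set \<Rightarrow> ('v \<Rightarrow> 'v \<Rightarrow> 'a) \<Rightarrow> 'v set \<Rightarrow> 'v set \<Rightarrow> 'a set" where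
  "reduced_form A I h C D = (\<Union>v\<in>C. \<Union>w\<in>D. I +>\<^bsub>A\<^esub> h v w)"

lemma hermitian_formD:
  assumes "hermitian_form A star V h" "u \<in> carrier V" "v \<in> carrier V"
  shows "h u v \<in> carrier A"
    and "w \<in> carrier V \<Longrightarrow> h (u \<oplus>\<^bsub>V\<^esub> v) w = h u w \<oplus>\<^bsub>A\<^esub> h v w"
    and "w \<in> carrier V \<Longrightarrow> h u (v \<oplus>\<^bsub>V\<^esub> w) = h u v \<oplus>\<^bsub>A\<^esub> h u w"
    and "a \<in> carrier A \<Longrightarrow> h u (v \<odot>\<^sub>r\<^bsub>V\<^esub> a) = h u v \<otimes>\<^bsub>A\<^esub> a"
    and "h v u = star (h u v)"
  using assms unfolding hermitian_form_def by blast+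

context right_module
begin

lemma ideal_multiple_abelian_subgroup:
  assumes "ideal I A"
  shows "abelian_subgroup (ideal_multiple V I) V"
proof -
  interpret ideal I A by fact
  have "{v \<odot>\<^sub>r\<^bsub>V\<^esub> a | v a. v \<in> carrier V \<and> a \<in> I} \<subseteq> carrier V"
    using a_subset by auto
  then have "subgroup (ideal_multiple V I) (add_monoid V)"
    unfolding ideal_multiple_def by (intro group.generate_is_subgroup V.a_group) simp
  then show ?thesis
    by (intro abelian_subgroupI3 additive_subgroup.intro V.abelian_group_axioms)
qed

lemma ideal_multiple_induct:
  assumes I: "ideal I A" and n: "n \<in> ideal_multiple V I"
    and gen: "\<And>v a. v \<in> carrier V \<Longrightarrow> a \<in> I \<Longrightarrow> P (v \<odot>\<^sub>r\<^bsub>V\<^esub> a)"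
    and zero: "P \<zero>\<^bsub>V\<^esub>"
    and minus: "\<And>v. v \<in> carrier V \<Longrightarrow> P v \<Longrightarrow> P (\<ominus>\<^bsub>V\<^esub> v)"
    and add: "\<And>v w. v \<in> carrier V \<Longrightarrow> w \<in> carrier V \<Longrightarrow> P v \<Longrightarrow> P w \<Longrightarrow> P (v \<oplus>\<^bsub>V\<^esub> w)"
  shows "P n"
proof -
  interpret ideal I A by fact
  have "n \<in> carrier V \<and> P n"
    using n unfolding ideal_multiple_def
  proof (induction rule: generate.induct)
    case one then show ?case using zero by simp
  next
    case (incl x) then show ?case using gen a_subset by auto
  next
    case (inv x)
    then have "x \<in> carrier V" "P x" using gen a_subset by auto
    then show ?case using minus by (simp flip: a_inv_def)
  next
    case (eng x y) then show ?case using add by simp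
  qed
  then show ?thesis ..
qed

lemma rsmult_hom:
  assumes "a \<in> carrier A"
  shows "abelian_group_hom V V (\<lambda>v. v \<odot>\<^sub>r\<^bsub>V\<^esub> a)"
  using assms
  by (intro abelian_group_homI V.abelian_group_axioms group_hom.intro group_hom_axioms.intro
      V.a_group) (auto simp: hom_def rsmult_l_distr)

lemma ideal_multiple_rsmult_closed:
  assumes I: "ideal I A" and n: "n \<in> ideal_multiple V I" and b: "b \<in> carrier A"
  shows "n \<odot>\<^sub>r\<^bsub>V\<^esub> b \<in> ideal_multiple V I"
proof -
  interpret ideal I A by fact
  interpret N: abelian_subgroup "ideal_multiple V I" V
    by (rule ideal_multiple_abelian_subgroup[OF I])
  interpret f: abelian_group_hom V V "\<lambda>v. v \<odot>\<^sub>r\<^bsub>V\<^esub> b"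
    by (rule rsmult_hom[OF b])
  show ?thesis
  proof (rule ideal_multiple_induct[OF I n])
    fix v a assume "v \<in> carrier V" "a \<in> I"
    moreover from this have "(v \<odot>\<^sub>r\<^bsub>V\<^esub> a) \<odot>\<^sub>r\<^bsub>V\<^esub> b = v \<odot>\<^sub>r\<^bsub>V\<^esub> (a \<otimes>\<^bsub>A\<^esub> b)"
      using b by (simp add: rsmult_assoc a_Hcarr)
    ultimately show "(v \<odot>\<^sub>r\<^bsub>V\<^esub> a) \<odot>\<^sub>r\<^bsub>V\<^esub> b \<in> ideal_multiple V I"
      using b I_r_closed unfolding ideal_multiple_def by (auto intro!: generate.incl)
  next
    show "\<zero>\<^bsub>V\<^esub> \<odot>\<^sub>r\<^bsub>V\<^esub> b \<in> ideal_multiple V I"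
      using f.hom_zero by simp
  next
    fix v assume "v \<in> carrier V" "v \<odot>\<^sub>r\<^bsub>V\<^esub> b \<in> ideal_multiple V I"
    then show "(\<ominus>\<^bsub>V\<^esub> v) \<odot>\<^sub>r\<^bsub>V\<^esub> b \<in> ideal_multiple V I"
      by (simp only: f.hom_a_inv N.a_inv_closed)
  next
    fix v w assume "v \<in> carrier V" "w \<in> carrier V"
      "v \<odot>\<^sub>r\<^bsub>V\<^esub> b \<in> ideal_multiple V I" "w \<odot>\<^sub>r\<^bsub>V\<^esub> b \<in> ideal_multiple V I"
    then show "(v \<oplus>\<^bsub>V\<^esub> w) \<odot>\<^sub>r\<^bsub>V\<^esub> b \<in> ideal_multiple V I"
      by (simp only: f.hom_add N.a_closed)
  qed
qed

lemma reduced_smult_coset: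
  assumes I: "ideal I A" and v: "v \<in> carrier V" and a: "a \<in> carrier A"
  shows "(ideal_multiple V I +>\<^bsub>V\<^esub> v) \<odot>\<^sub>r\<^bsub>reduced_rmodule V I\<^esub> (I +>\<^bsub>A\<^esub> a) =
    ideal_multiple V I +>\<^bsub>V\<^esub> (v \<odot>\<^sub>r\<^bsub>V\<^esub> a)"
proof -
  interpret ideal I A by fact
  interpret N: abelian_subgroup "ideal_multiple V I" V
    by (rule ideal_multiple_abelian_subgroup[OF I])
  have eq: "ideal_multiple V I +>\<^bsub>V\<^esub> (x \<odot>\<^sub>r\<^bsub>V\<^esub> b) = ideal_multiple V I +>\<^bsub>V\<^esub> (v \<odot>\<^sub>r\<^bsub>V\<^esub> a)"
    if x: "x \<in> ideal_multiple V I +>\<^bsub>V\<^esub> v" and b: "b \<in> I +>\<^bsub>A\<^esub> a" for x b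
  proof -
    obtain n where n: "n \<in> ideal_multiple V I" "x = n \<oplus>\<^bsub>V\<^esub> v"
      using x by (auto simp: a_r_coset_def')
    obtain i where i: "i \<in> I" "b = i \<oplus>\<^bsub>A\<^esub> a"
      using b by (auto simp: a_r_coset_def')
    have carr: "n \<in> carrier V" "i \<in> carrier A" "b \<in> carrier A"
      using n i a by (auto simp: a_Hcarr N.a_Hcarr)
    have "v \<odot>\<^sub>r\<^bsub>V\<^esub> i \<in> ideal_multiple V I"
      using v i unfolding ideal_multiple_def by (auto intro!: generate.incl)
    then have k: "n \<odot>\<^sub>r\<^bsub>V\<^esub> b \<oplus>\<^bsub>V\<^esub> v \<odot>\<^sub>r\<^bsub>V\<^esub> i \<in> ideal_multiple V I"
      using ideal_multiple_rsmult_closed[OF I n(1) carr(3)] by simp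
    have "x \<odot>\<^sub>r\<^bsub>V\<^esub> b = n \<odot>\<^sub>r\<^bsub>V\<^esub> b \<oplus>\<^bsub>V\<^esub> v \<odot>\<^sub>r\<^bsub>V\<^esub> b"
      using n carr v by (simp add: rsmult_l_distr)
    also have "v \<odot>\<^sub>r\<^bsub>V\<^esub> b = v \<odot>\<^sub>r\<^bsub>V\<^esub> i \<oplus>\<^bsub>V\<^esub> v \<odot>\<^sub>r\<^bsub>V\<^esub> a"
      using i carr v a by (simp add: rsmult_r_distr)
    finally have "x \<odot>\<^sub>r\<^bsub>V\<^esub> b = (n \<odot>\<^sub>r\<^bsub>V\<^esub> b \<oplus>\<^bsub>V\<^esub> v \<odot>\<^sub>r\<^bsub>V\<^esub> i) \<oplus>\<^bsub>V\<^esub> v \<odot>\<^sub>r\<^bsub>V\<^esub> a"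
      using carr v a by (simp add: V.a_assoc)
    then have "x \<odot>\<^sub>r\<^bsub>V\<^esub> b \<in> ideal_multiple V I +>\<^bsub>V\<^esub> (v \<odot>\<^sub>r\<^bsub>V\<^esub> a)"
      using k by (auto simp: a_r_coset_def')
    then show ?thesis
      using N.a_repr_independence' v a by (metis rsmult_closed)
  qed
  have "v \<in> ideal_multiple V I +>\<^bsub>V\<^esub> v" "a \<in> I +>\<^bsub>A\<^esub> a"
    using v a N.a_rcos_self a_rcos_self by auto
  then have "ideal_multiple V I +>\<^bsub>V\<^esub> v \<noteq> {}" "I +>\<^bsub>A\<^esub> a \<noteq> {}"
    by auto
  then show ?thesis
    unfolding reduced_rmodule_def by (simp add: eq cong: SUP_cong)
qed

lemma hermitian_form_ideal_multiple:
  assumes I: "ideal I A" and h: "hermitian_form A star V h"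
    and n: "n \<in> ideal_multiple V I" and u: "u \<in> carrier V"
  shows "h u n \<in> I"
proof -
  interpret ideal I A by fact
  interpret f: abelian_group_hom V A "h u"
    using h u
    by (intro abelian_group_homI V.abelian_group_axioms A.abelian_group_axioms group_hom.intro
        group_hom_axioms.intro V.a_group A.a_group) (auto simp: hom_def hermitian_formD(1,3)[OF h])
  show ?thesis
  proof (rule ideal_multiple_induct[OF I n])
    fix v a assume va: "v \<in> carrier V" "a \<in> I"
    then have "h u (v \<odot>\<^sub>r\<^bsub>V\<^esub> a) = h u v \<otimes>\<^bsub>A\<^esub> a" "h u v \<in> carrier A"
      using u a_Hcarr by (auto simp: hermitian_formD(1,4)[OF h])
    then show "h u (v \<odot>\<^sub>r\<^bsub>V\<^esub> a) \<in> I"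
      using va I_l_closed by auto
  next
    show "h u \<zero>\<^bsub>V\<^esub> \<in> I"
      using f.hom_zero by simp
  next
    fix v assume "v \<in> carrier V" "h u v \<in> I"
    then show "h u (\<ominus>\<^bsub>V\<^esub> v) \<in> I"
      by (simp only: f.hom_a_inv a_inv_closed)
  next
    fix v w assume "v \<in> carrier V" "w \<in> carrier V" "h u v \<in> I" "h u w \<in> I"
    then show "h u (v \<oplus>\<^bsub>V\<^esub> w) \<in> I"
      by (simp only: f.hom_add a_closed)
  qed
qed

lemma reduced_form_coset:
  assumes I: "ideal I A" and star: "star ` I \<subseteq> I"
    and h: "hermitian_form A star V h" and v: "v \<in> carrier V" and w: "w \<in> carrier V"
  shows "reduced_form A I h (ideal_multiple V I +>\<^bsub>V\<^esub> v) (ideal_multiple V I +>\<^bsub>V\<^esub> w) =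
    I +>\<^bsub>A\<^esub> h v w"
proof -
  interpret ideal I A by fact
  interpret N: abelian_subgroup "ideal_multiple V I" V
    by (rule ideal_multiple_abelian_subgroup[OF I])
  have hc: "h x y \<in> carrier A" if "x \<in> carrier V" "y \<in> carrier V" for x y
    using that by (rule hermitian_formD(1)[OF h])
  have eq: "I +>\<^bsub>A\<^esub> h x y = I +>\<^bsub>A\<^esub> h v w"
    if x: "x \<in> ideal_multiple V I +>\<^bsub>V\<^esub> v" and y: "y \<in> ideal_multiple V I +>\<^bsub>V\<^esub> w" for x y
  proof -
    obtain n where n: "n \<in> ideal_multiple V I" "x = n \<oplus>\<^bsub>V\<^esub> v"
      using x by (auto simp: a_r_coset_def')
    obtain k where k: "k \<in> ideal_multiple V I" "y = k \<oplus>\<^bsub>V\<^esub> w"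
      using y by (auto simp: a_r_coset_def')
    have carr: "n \<in> carrier V" "k \<in> carrier V" "y \<in> carrier V"
      using n k w by (auto simp: N.a_Hcarr)
    have "h n y = star (h y n)"
      using carr by (intro hermitian_formD(5)[OF h])
    then have 1: "h n y \<in> I"
      using star hermitian_form_ideal_multiple[OF I h n(1) carr(3)] by auto
    have 2: "h v k \<in> I"
      by (rule hermitian_form_ideal_multiple[OF I h k(1) v])
    have "h x y = h n y \<oplus>\<^bsub>A\<^esub> h v y"
      using n carr v by (simp add: hermitian_formD(2)[OF h])
    also have "h v y = h v k \<oplus>\<^bsub>A\<^esub> h v w"
      using k carr v w by (simp add: hermitian_formD(3)[OF h])
    finally have "h x y = (h n y \<oplus>\<^bsub>A\<^esub> h v k) \<oplus>\<^bsub>A\<^esub> h v w"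
      using hc carr v w by (simp add: A.a_assoc)
    then have "h x y \<in> I +>\<^bsub>A\<^esub> h v w"
      using 1 2 by (auto simp: a_r_coset_def')
    then show ?thesis
      using a_repr_independence' hc v w by metis
  qed
  have "v \<in> ideal_multiple V I +>\<^bsub>V\<^esub> v" "w \<in> ideal_multiple V I +>\<^bsub>V\<^esub> w"
    using v w N.a_rcos_self by auto
  then have "ideal_multiple V I +>\<^bsub>V\<^esub> v \<noteq> {}" "ideal_multiple V I +>\<^bsub>V\<^esub> w \<noteq> {}"
    by auto
  then show ?thesis
    unfolding reduced_form_def by (simp add: eq cong: SUP_cong)
qed

end

end

theory Submission
  imports Defs "HOL-Algebra.Sylow" "HOL-Algebra.Subrings"
begin

text \<open>
  Write \<open>\<rr>\<close> and \<open>\<mm>\<close> for the radicals of \<open>A\<close> and of its fixed ring, \<open>\<ss>\<close> for the trace kernel,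
  \<open>N\<close> for \<open>V\<rr>\<close> and \<open>Vbar\<close> for \<open>V/N\<close>. The set \<open>S\<close> of all automorphisms of \<open>V\<close> that preserve \<open>h\<close>
  only modulo \<open>\<rr>\<close> (\<open>near_isometries\<close> below) is counted in two ways.

  By reduction: a linear map of \<open>Vbar\<close> lifts to \<open>V\<close> by choosing the image of each of the \<open>m\<close> basis
  vectors in a prescribed coset of \<open>N\<close>, and \<open>N\<close> has \<open>|\<rr>|\<^sup>m\<close> elements. By Nakayama's lemma
  every lift of an automorphism is an automorphism, and it preserves \<open>h\<close> modulo \<open>\<rr>\<close> exactly
  if its reduction preserves the reduced form. So \<open>|S|\<close> is the order of the unitary group of \<open>Vbar\<close>
  times \<open>|\<rr>|\<close> to the power \<open>m\<^sup>2\<close> (\<open>card_near_isometries_by_reduction\<close>).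

  By Gram matrices: send \<open>g \<in> S\<close> to the hermitian matrix with entries \<open>h (g e\<^sub>i) (g e\<^sub>j)\<close>.
  Two elements have the same image exactly if they differ by an isometry, so every non-empty fibre
  is a coset of the unitary group of \<open>V\<close>. The image consists of all hermitian matrices congruent
  modulo \<open>\<rr>\<close> to the Gram matrix of \<open>h\<close>: such a matrix has free entries in a coset of \<open>\<rr>\<close> below
  the diagonal and fixed entries, hence entries in a coset of \<open>\<mm>\<close>, on the diagonal. So \<open>|S|\<close> is
  also the order of the unitary group of \<open>V\<close> times \<open>|\<rr>|\<close> to the power \<open>m(m-1)/2\<close> times \<open>|\<mm>|\<^sup>m\<close>
  (\<open>card_near_isometries_by_gram\<close>). Comparing the two counts and using \<open>|\<rr>| = |\<mm>| |\<ss>|\<close>, which holds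
  because 2 is invertible and so the trace is onto, gives both formulas.

  The main point is that every such hermitian matrix occurs (\<open>gram_surj\<close>). By
  non-degeneracy the form with that Gram matrix is \<open>h (Y v) w\<close> for a linear map \<open>Y\<close> which is
  self-adjoint and congruent to the identity modulo \<open>N\<close>. The maps congruent to the identity form a
  finite group, of order a power of the odd number \<open>|\<rr>|\<close>. Hence \<open>Y\<close> has a square root \<open>X\<close> among its own
  powers, \<open>X\<close> is self-adjoint as well, and \<open>h (X v) (X w) = h v (X (X w)) = h v (Y w) = h (Y v) w\<close>.
  Taking powers in a group of odd order thus replaces a successive approximation of \<open>X\<close> modulo
  the powers of \<open>\<rr>\<close>.
\<close>

section \<open>The Jacobson radical of a finite ring\<close>

lemma (in ring) right_idealI:
  assumes "I \<subseteq> carrier R" "\<zero> \<in> I"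
    and add: "\<And>x y. x \<in> I \<Longrightarrow> y \<in> I \<Longrightarrow> x \<oplus> y \<in> I"
    and mult: "\<And>x a. x \<in> I \<Longrightarrow> a \<in> carrier R \<Longrightarrow> x \<otimes> a \<in> I"
  shows "right_ideal I R"
proof -
  have neg: "\<ominus> x \<in> I" if x: "x \<in> I" for x
  proof -
    have "\<ominus> x = x \<otimes> (\<ominus> \<one>)" using x assms(1) by (auto simp: r_minus)
    then show ?thesis using mult[OF x, of "\<ominus> \<one>"] by simp
  qed
  have "additive_subgroup I R"
    by (intro additive_subgroup.intro add.subgroupI) (use assms neg in auto)
  then show ?thesis
    by (simp add: right_ideal_def right_ideal_axioms_def ring_axioms mult)
qed

lemma (in right_ideal) eq_carrier_if_one_mem: "\<one> \<in> I \<Longrightarrow> I = carrier A"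
  using I_r_closed[of \<one>] a_subset by auto

locale finite_ring = ring R for R (structure) +
  assumes finite_carrier: "finite (carrier R)"
begin

text \<open>If \<open>x y = 1\<close>, left multiplication by \<open>y\<close> is injective, hence onto by finiteness, and so \<open>y\<close> has a
  right inverse too.\<close>

lemma right_inverse_Unit:
  assumes x: "x \<in> carrier R" and y: "y \<in> carrier R" and xy: "x \<otimes> y = \<one>"
  shows "x \<in> Units R"
proof -
  have "inj_on (\<lambda>z. y \<otimes> z) (carrier R)"
  proof (rule inj_onI)
    fix z z' assume z: "z \<in> carrier R" "z' \<in> carrier R" and eq: "y \<otimes> z = y \<otimes> z'"
    have "x \<otimes> (y \<otimes> z) = x \<otimes> (y \<otimes> z')" by (simp only: eq)
    then show "z = z'" using x y z xy by (simp flip: m_assoc)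
  qed
  then have "(\<lambda>z. y \<otimes> z) ` carrier R = carrier R"
    using y by (intro endo_inj_surj finite_carrier) auto
  then obtain w where w: "w \<in> carrier R" "\<one> = y \<otimes> w" by (metis one_closed imageE)
  have "w = x \<otimes> (y \<otimes> w)" using x y w(1) xy by (simp flip: m_assoc)
  then have "w = x" by (simp add: x flip: w(2))
  then have "y \<otimes> x = \<one>" using w by simp
  then show ?thesis using x y xy by (auto simp: Units_def)
qed

lemma maximal_right_ideal_above:
  assumes "right_ideal I R" "I \<noteq> carrier R"
  obtains M where "maximal_right_ideal M R" "I \<subseteq> M"
proof -
  let ?S = "{J. right_ideal J R \<and> J \<noteq> carrier R}"
  have "?S \<subseteq> Pow (carrier R)"
    by (auto simp: right_ideal_def dest: additive_subgroup.a_subset)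
  then have "finite ?S" by (rule finite_subset) (simp add: finite_carrier)
  then obtain M where "M \<in> ?S" "I \<subseteq> M" "\<forall>J\<in>?S. M \<subseteq> J \<longrightarrow> M = J"
    using finite_has_maximal2[of ?S I] assms by auto
  then have "maximal_right_ideal M R" unfolding maximal_right_ideal_def by blast
  with \<open>I \<subseteq> M\<close> show ?thesis by (rule that[rotated])
qed

text \<open>From here on this elementwise description replaces the maximal right ideals. Since \<open>1 - x y\<close> and
  \<open>1 - y x\<close> are units together, it also shows that the radical is a left ideal.\<close>

lemma jacobson_radical_iff:
  "x \<in> jacobson_radical R \<longleftrightarrow>
     x \<in> carrier R \<and> (\<forall>a\<in>carrier R. \<one> \<ominus> x \<otimes> a \<in> Units R)"
proof (intro iffI conjI ballI)
  assume x: "x \<in> jacobson_radical R"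
  then show xc: "x \<in> carrier R" by (simp add: jacobson_radical_def)
  fix a assume a: "a \<in> carrier R"
  let ?u = "\<one> \<ominus> x \<otimes> a"
  have u: "?u \<in> carrier R" using xc a by simp
  let ?I = "{?u \<otimes> b | b. b \<in> carrier R}"
  have I: "right_ideal ?I R"
  proof (rule right_idealI)
    show "?I \<subseteq> carrier R" using u by auto
    show "\<zero> \<in> ?I" using u by (auto intro!: exI[of _ \<zero>])
    show "v \<oplus> w \<in> ?I" if "v \<in> ?I" "w \<in> ?I" for v w
      using that u by (auto simp flip: r_distr)
    show "v \<otimes> b \<in> ?I" if "v \<in> ?I" "b \<in> carrier R" for v b
      using that u by (auto simp: m_assoc)
  qed
  have "?I = carrier R"
  proof (rule ccontr)
    assume "?I \<noteq> carrier R"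
    then obtain M where M: "maximal_right_ideal M R" "?I \<subseteq> M"
      using maximal_right_ideal_above I by blast
    interpret M: right_ideal M R using M(1) by (simp add: maximal_right_ideal_def)
    have "?u \<otimes> \<one> \<in> M" using M(2) by blast
    moreover have "x \<otimes> a \<in> M"
      using x M(1) a by (auto simp: jacobson_radical_def intro: M.I_r_closed)
    ultimately have "?u \<oplus> x \<otimes> a \<in> M" using u by simp
    moreover have "?u \<oplus> x \<otimes> a = \<one>" using xc a by (simp add: a_minus_def a_assoc l_neg)
    ultimately show False
      using M.eq_carrier_if_one_mem M(1) by (simp add: maximal_right_ideal_def)
  qed
  then obtain b where "b \<in> carrier R" "?u \<otimes> b = \<one>" using one_closed by (smt (verit) mem_Collect_eq)
  then show "?u \<in> Units R" using right_inverse_Unit u by blast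
next
  assume x: "x \<in> carrier R \<and> (\<forall>a\<in>carrier R. \<one> \<ominus> x \<otimes> a \<in> Units R)"
  then have xc: "x \<in> carrier R" ..
  have "x \<in> M" if M: "maximal_right_ideal M R" for M
  proof (rule ccontr)
    assume xM: "x \<notin> M"
    interpret M: right_ideal M R using M by (simp add: maximal_right_ideal_def)
    let ?J = "{i \<oplus> x \<otimes> a | i a. i \<in> M \<and> a \<in> carrier R}"
    have J: "right_ideal ?J R"
    proof (rule right_idealI)
      show "?J \<subseteq> carrier R" using xc by auto
      show "\<zero> \<in> ?J" using xc by (auto intro!: exI[of _ \<zero>])
      show "v \<oplus> w \<in> ?J" if "v \<in> ?J" "w \<in> ?J" for v w
      proof -
        from that(1) obtain i a where "i \<in> M" "a \<in> carrier R" "v = i \<oplus> x \<otimes> a"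
          by (elim CollectE exE conjE)
        moreover from that(2) obtain k b where "k \<in> M" "b \<in> carrier R" "w = k \<oplus> x \<otimes> b"
          by (elim CollectE exE conjE)
        ultimately have "v \<oplus> w = (i \<oplus> k) \<oplus> x \<otimes> (a \<oplus> b)" "i \<oplus> k \<in> M" "a \<oplus> b \<in> carrier R"
          using xc by (simp_all add: r_distr a_ac)
        then show ?thesis by blast
      qed
      show "v \<otimes> b \<in> ?J" if "v \<in> ?J" "b \<in> carrier R" for v b
      proof -
        from that(1) obtain i a where "i \<in> M" "a \<in> carrier R" "v = i \<oplus> x \<otimes> a"
          by (elim CollectE exE conjE)
        then have "v \<otimes> b = i \<otimes> b \<oplus> x \<otimes> (a \<otimes> b)" "i \<otimes> b \<in> M" "a \<otimes> b \<in> carrier R"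
          using xc that(2) by (simp_all add: l_distr m_assoc M.I_r_closed)
        then show ?thesis by blast
      qed
    qed
    have "M \<subseteq> ?J"
    proof
      fix i assume i: "i \<in> M"
      then have "i = i \<oplus> x \<otimes> \<zero>" using xc by simp
      then show "i \<in> ?J" using i by blast
    qed
    moreover have "x \<in> ?J" 
    proof -
      have "x = \<zero> \<oplus> x \<otimes> \<one>" "\<zero> \<in> M" using xc by simp_all
      then show ?thesis by blast
    qed
    ultimately have "?J = carrier R"
      using J M xM unfolding maximal_right_ideal_def by blast
    then obtain i a where ia: "i \<in> M" "a \<in> carrier R" "\<one> = i \<oplus> x \<otimes> a"
      using one_closed by (smt (verit) mem_Collect_eq)
    then have "\<one> \<ominus> x \<otimes> a = i" using xc by (simp add: a_minus_def a_assoc r_neg)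
    then have "i \<in> Units R" using x ia by auto
    then have "\<one> \<in> M" using M.I_r_closed[OF ia(1)] by (metis Units_inv_closed Units_r_inv)
    then show False
      using M.eq_carrier_if_one_mem M by (simp add: maximal_right_ideal_def)
  qed
  then show "x \<in> jacobson_radical R" using xc by (simp add: jacobson_radical_def)
qed

lemma jacobson_radical_carrier: "x \<in> jacobson_radical R \<Longrightarrow> x \<in> carrier R"
  by (simp add: jacobson_radical_def)

text \<open>If \<open>z\<close> inverts \<open>1 - x y\<close>, then \<open>1 + y z x\<close> inverts \<open>1 - y x\<close>.\<close>

lemma one_minus_mult_commute_Unit:
  assumes x: "x \<in> carrier R" and y: "y \<in> carrier R" and u: "\<one> \<ominus> x \<otimes> y \<in> Units R"
  shows "\<one> \<ominus> y \<otimes> x \<in> Units R"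
proof -
  define z where "z = inv (\<one> \<ominus> x \<otimes> y)"
  have z: "z \<in> carrier R" "(\<one> \<ominus> x \<otimes> y) \<otimes> z = \<one>" using u by (auto simp: z_def)
  have "(\<one> \<ominus> y \<otimes> x) \<otimes> (\<one> \<oplus> y \<otimes> z \<otimes> x)
      = \<one> \<ominus> y \<otimes> x \<oplus> y \<otimes> ((\<one> \<ominus> x \<otimes> y) \<otimes> z) \<otimes> x"
    using x y z(1) 
    by (simp add: a_minus_def l_distr r_distr l_minus r_minus m_assoc a_ac)
  also have "\<dots> = \<one>" using x y by (subst z(2)) (simp add: a_minus_def a_assoc l_neg)
  finally show ?thesis using x y z(1) by (intro right_inverse_Unit) auto
qed

text \<open>Closure under left multiplication comes from moving the left factor around the product
  in \<open>1 - b (x a)\<close>.\<close>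

lemma jacobson_radical_ideal: "ideal (jacobson_radical R) R"
proof -
  have "right_ideal (jacobson_radical R) R"
  proof (rule right_idealI)
    have M: "right_ideal M R" if "maximal_right_ideal M R" for M
      using that by (simp add: maximal_right_ideal_def)
    then have sg: "additive_subgroup M R" if "maximal_right_ideal M R" for M
      using that by (simp add: right_ideal_def)
    show "jacobson_radical R \<subseteq> carrier R" by (auto simp: jacobson_radical_def)
    show "\<zero> \<in> jacobson_radical R"
      using sg by (auto simp: jacobson_radical_def additive_subgroup.zero_closed)
    show "x \<oplus> y \<in> jacobson_radical R"
      if "x \<in> jacobson_radical R" "y \<in> jacobson_radical R" for x y
      using sg that by (auto simp: jacobson_radical_def additive_subgroup.a_closed)
    show "x \<otimes> a \<in> jacobson_radical R" if "x \<in> jacobson_radical R" "a \<in> carrier R" for x a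
      using M that by (auto simp: jacobson_radical_def intro: right_ideal.I_r_closed)
  qed
  then interpret J: right_ideal "jacobson_radical R" R .
  show ?thesis
  proof (rule idealI)
    show "x \<otimes> b \<in> jacobson_radical R" if "x \<in> jacobson_radical R" "b \<in> carrier R" for x b
      using that by (rule J.I_r_closed)
  next
    fix x b assume x: "x \<in> jacobson_radical R" and b: "b \<in> carrier R"
    have xc: "x \<in> carrier R" using x by (rule jacobson_radical_carrier)
    have "\<one> \<ominus> (b \<otimes> x) \<otimes> a \<in> Units R" if a: "a \<in> carrier R" for a
    proof -
      have "\<one> \<ominus> (x \<otimes> a) \<otimes> b \<in> Units R"
        using x a b xc jacobson_radical_iff[of x] by (simp add: m_assoc)
      then have "\<one> \<ominus> b \<otimes> (x \<otimes> a) \<in> Units R"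
        by (rule one_minus_mult_commute_Unit[rotated 2]) (simp_all add: xc a b)
      then show ?thesis by (simp only: m_assoc[OF b xc a])
    qed
    then show "b \<otimes> x \<in> jacobson_radical R"
      using xc b by (intro jacobson_radical_iff[THEN iffD2] conjI ballI m_closed)
  qed (simp_all add: ring_axioms J.a_subgroup)
qed

lemma one_minus_jacobson_radical_Unit:
  assumes "x \<in> jacobson_radical R" shows "\<one> \<ominus> x \<in> Units R"
  using assms jacobson_radical_iff[of x] by (auto dest!: bspec[of _ _ \<one>])

end

locale finite_local_ring = finite_ring +
  assumes local: "local_ring R"
begin

lemma one_not_in_jacobson_radical: "\<one> \<notin> jacobson_radical R"
proof
  interpret J: ideal "jacobson_radical R" R by (rule jacobson_radical_ideal)
  assume "\<one> \<in> jacobson_radical R"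
  then have "jacobson_radical R +> \<one> = jacobson_radical R"
    by (simp add: J.a_rcos_const)
  then show False
    using local by (auto simp: local_ring_def division_ring_def FactRing_def)
qed

lemma Units_eq: "Units R = carrier R - jacobson_radical R"
proof (intro equalityI subsetI)
  interpret J: ideal "jacobson_radical R" R by (rule jacobson_radical_ideal)
  fix x assume "x \<in> Units R"
  then show "x \<in> carrier R - jacobson_radical R"
    using J.I_r_closed[of x "inv x"] one_not_in_jacobson_radical by auto
next
  interpret J: ideal "jacobson_radical R" R by (rule jacobson_radical_ideal)
  fix x assume x: "x \<in> carrier R - jacobson_radical R"
  let ?Q = "R Quot jacobson_radical R"
  have "jacobson_radical R +> x \<noteq> jacobson_radical R"
    using x J.a_rcos_self[of x] by auto
  then have "jacobson_radical R +> x \<in> Units ?Q"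
    using local x by (auto simp: local_ring_def division_ring_def FactRing_simps)
  then obtain Y where "Y \<in> carrier ?Q"
    "(jacobson_radical R +> x) \<otimes>\<^bsub>?Q\<^esub> Y = \<one>\<^bsub>?Q\<^esub>"
    by (auto simp: Units_def)
  then obtain y where y: "y \<in> carrier R"
    and "(jacobson_radical R +> x) \<otimes>\<^bsub>?Q\<^esub> (jacobson_radical R +> y) = \<one>\<^bsub>?Q\<^esub>"
    by (auto simp: FactRing_simps)
  then have "jacobson_radical R +> (x \<otimes> y) = jacobson_radical R +> \<one>"
    using x by (simp add: FactRing_def J.rcoset_mult_add)
  then have "x \<otimes> y \<in> jacobson_radical R +> \<one>"
    using x y J.a_rcos_self[of "x \<otimes> y"] by simp
  then obtain j where j: "j \<in> jacobson_radical R" "x \<otimes> y = j \<oplus> \<one>"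
    by (auto simp: a_r_coset_def')
  then have "x \<otimes> y = \<one> \<ominus> (\<ominus> j)" "\<ominus> j \<in> jacobson_radical R"
    by (simp_all add: a_minus_def a_comm)
  then have u: "x \<otimes> y \<in> Units R" using one_minus_jacobson_radical_Unit by simp
  have "x \<otimes> (y \<otimes> inv (x \<otimes> y)) = \<one>" using u x y by (simp flip: m_assoc)
  then show "x \<in> Units R" using u x y by (intro right_inverse_Unit[of x]) auto
qed

end

section \<open>Involutions of finite local rings\<close>

locale involutive_local_ring = finite_local_ring +
  fixes star :: "'a \<Rightarrow> 'a"
  assumes involution: "ring_involution R star"
    and fixed_points_central: "fixed_points R star \<subseteq> ring_center R"
    and odd_residue_characteristic:
      "odd (ring_characteristic (fixed_ring R star Quot jacobson_radical (fixed_ring R star)))"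
begin

lemma star_closed [simp]: "x \<in> carrier R \<Longrightarrow> star x \<in> carrier R"
  and star_add: "x \<in> carrier R \<Longrightarrow> y \<in> carrier R \<Longrightarrow> star (x \<oplus> y) = star x \<oplus> star y"
  and star_mult: "x \<in> carrier R \<Longrightarrow> y \<in> carrier R \<Longrightarrow> star (x \<otimes> y) = star y \<otimes> star x"
  and star_one [simp]: "star \<one> = \<one>"
  and star_star [simp]: "x \<in> carrier R \<Longrightarrow> star (star x) = x"
  using involution
  by (auto simp: ring_involution_def ring_iso_def ring_hom_def opposite_ring_def)

lemma star_zero [simp]: "star \<zero> = \<zero>"
proof -
  have "star \<zero> \<oplus> star \<zero> = star \<zero>" by (simp flip: star_add)
  then show ?thesis by (metis add.l_cancel_one' zero_closed star_closed)
qed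

lemma star_minus: "x \<in> carrier R \<Longrightarrow> star (\<ominus> x) = \<ominus> star x"
  by (rule minus_equality[symmetric]) (simp_all add: l_neg flip: star_add)

lemma star_Unit: "x \<in> Units R \<Longrightarrow> star x \<in> Units R"
  by (rule right_inverse_Unit[of _ "star (inv x)"]) (simp_all add: star_mult[symmetric] Units_closed)

sublocale J: ideal "jacobson_radical R" R
  by (rule jacobson_radical_ideal)

lemma star_jacobson_radical [simp]:
  assumes x: "x \<in> jacobson_radical R" shows "star x \<in> jacobson_radical R"
proof (rule ccontr)
  have xc: "x \<in> carrier R" using x by (rule jacobson_radical_carrier)
  assume "star x \<notin> jacobson_radical R"
  then have "star x \<in> Units R"
    by (simp only: Units_eq Diff_iff star_closed[OF xc] simp_thms)
  then have "star (star x) \<in> Units R" by (rule star_Unit)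
  then have "x \<in> Units R" by (simp only: star_star[OF xc])
  then show False using x Units_eq by blast
qed

abbreviation "fixed \<equiv> fixed_points R star"

lemma fixed_carrier: "x \<in> fixed \<Longrightarrow> x \<in> carrier R"
  and fixed_commute: "x \<in> fixed \<Longrightarrow> a \<in> carrier R \<Longrightarrow> x \<otimes> a = a \<otimes> x"
  using fixed_points_central by (auto simp: fixed_points_def ring_center_def)

lemma fixed_subring: "subring fixed R"
proof (rule subringI)
  show "x \<otimes> y \<in> fixed" if "x \<in> fixed" "y \<in> fixed" for x y
    using that fixed_commute[OF that(2) fixed_carrier[OF that(1)]]
    by (simp add: fixed_points_def star_mult)
  show "fixed \<subseteq> carrier R" by (auto simp: fixed_carrier)
  show "\<one> \<in> fixed" by (simp add: fixed_points_def)
  show "\<ominus> x \<in> fixed" if "x \<in> fixed" for x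
    using that by (simp add: fixed_points_def star_minus)
  show "x \<oplus> y \<in> fixed" if "x \<in> fixed" "y \<in> fixed" for x y
    using that by (simp add: fixed_points_def star_add)
qed

sublocale F: finite_ring "fixed_ring R star"
proof -
  have "ring (fixed_ring R star)"
    unfolding fixed_ring_def by (rule subring_is_ring[OF fixed_subring])
  moreover have "finite fixed" using finite_carrier by (rule rev_finite_subset) (auto simp: fixed_points_def)
  ultimately show "finite_ring (fixed_ring R star)"
    by (simp add: finite_ring_def finite_ring_axioms_def) (simp add: fixed_ring_def)
qed

lemma fixed_ring_simps [simp]:
  "carrier (fixed_ring R star) = fixed" "monoid.mult (fixed_ring R star) = monoid.mult R"
  "add (fixed_ring R star) = add R" "\<one>\<^bsub>fixed_ring R star\<^esub> = \<one>" "\<zero>\<^bsub>fixed_ring R star\<^esub> = \<zero>"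
  by (simp_all add: fixed_ring_def)

lemma fixed_Units: "x \<in> Units (fixed_ring R star) \<longleftrightarrow> x \<in> fixed \<and> x \<in> Units R"
proof
  assume "x \<in> Units (fixed_ring R star)"
  then show "x \<in> fixed \<and> x \<in> Units R"
    using fixed_carrier by (auto simp: Units_def)
next
  assume x: "x \<in> fixed \<and> x \<in> Units R"
  have "star (inv x) = inv (star x)"
    using x by (intro inv_unique') (simp_all add: star_mult[symmetric] Units_closed)
  then have "inv x \<in> fixed" using x by (simp add: fixed_points_def)
  then show "x \<in> Units (fixed_ring R star)" 
    using x unfolding Units_def[of "fixed_ring R star"]
    by (auto intro!: bexI[of _ "inv x"])
qed

lemma fixed_minus: "x \<in> fixed \<Longrightarrow> y \<in> fixed \<Longrightarrow> x \<ominus>\<^bsub>fixed_ring R star\<^esub> y = x \<ominus> y"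
proof -
  assume x: "x \<in> fixed" and y: "y \<in> fixed"
  have "(\<ominus>\<^bsub>fixed_ring R star\<^esub> y) \<oplus> y = \<zero>" "\<ominus>\<^bsub>fixed_ring R star\<^esub> y \<in> fixed"
    using F.l_neg[of y] F.a_inv_closed[of y] y by simp_all
  then have "\<ominus>\<^bsub>fixed_ring R star\<^esub> y = \<ominus> y"
    using y fixed_carrier by (intro minus_equality[symmetric]) auto
  then show ?thesis by (simp add: a_minus_def)
qed

text \<open>The inverse of a fixed unit is fixed, so fixed elements are units of the fixed ring exactly
  if they are units of the whole ring. For the inclusion from left to right, locality is
  essential: a non-unit of the whole ring lies in its radical.\<close>

lemma jacobson_radical_fixed:
  "jacobson_radical (fixed_ring R star) = fixed \<inter> jacobson_radical R"
proof (intro equalityI subsetI IntI)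
  fix x assume x: "x \<in> jacobson_radical (fixed_ring R star)"
  then show xf: "x \<in> fixed" using F.jacobson_radical_carrier by fastforce
  show "x \<in> jacobson_radical R"
  proof (rule ccontr)
    assume "x \<notin> jacobson_radical R"
    then have u: "x \<in> Units (fixed_ring R star)"
      using xf by (simp add: fixed_Units Units_eq fixed_carrier)
    then have "\<one> \<in> jacobson_radical (fixed_ring R star)"
      using ideal.I_r_closed[OF F.jacobson_radical_ideal x F.Units_inv_closed[OF u]] F.Units_r_inv[OF u]
      by simp
    then have "\<one> \<ominus>\<^bsub>fixed_ring R star\<^esub> \<one> \<in> Units (fixed_ring R star)"
      using F.one_minus_jacobson_radical_Unit by fastforce
    then have "\<zero> \<in> Units R" using F.one_closed r_right_minus_eq[of \<one> \<one>]
      by (metis F.one_closed fixed_Units fixed_minus fixed_ring_simps(1) fixed_ring_simps(4) one_closed)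
    then show False by (simp add: Units_eq)
  qed
next
  fix x assume x: "x \<in> fixed \<inter> jacobson_radical R"
  have "\<one> \<ominus> x \<otimes> a \<in> Units R" if "a \<in> fixed" for a
    using x that fixed_carrier by (intro one_minus_jacobson_radical_Unit J.I_r_closed) auto
  moreover have "x \<otimes> a \<in> fixed" "\<one> \<in> fixed" if "a \<in> fixed" for a
    using F.m_closed[of x a] x that F.one_closed by auto
  ultimately show "x \<in> jacobson_radical (fixed_ring R star)"
    using x F.minus_closed[of \<one>] by (auto simp: F.jacobson_radical_iff fixed_Units fixed_minus)
qed

text \<open>The odd residue characteristic \<open>k = 2l + 1\<close> satisfies \<open>k \<cdot> 1 \<in> \<rr>\<close>, so that
  \<open>2 (-l) = 1 - k \<cdot> 1\<close> is a unit.\<close>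

lemma two_Unit: "\<one> \<oplus> \<one> \<in> Units R"
proof -
  let ?F = "fixed_ring R star" 
  let ?m = "jacobson_radical ?F"
  interpret m: ideal ?m ?F by (rule F.jacobson_radical_ideal)
  interpret Q: ring "?F Quot ?m" by (rule m.quotient_is_ring)
  define k where "k = ring_characteristic (?F Quot ?m)"
  have "add_pow (?F Quot ?m) k \<one>\<^bsub>?F Quot ?m\<^esub> = \<zero>\<^bsub>?F Quot ?m\<^esub>"
    unfolding k_def ring_characteristic_def
    using Q.add.pow_ord_eq_1[OF Q.one_closed] by (simp add: add_pow_def)
  moreover have pow: "add_pow (?F Quot ?m) n \<one>\<^bsub>?F Quot ?m\<^esub> = ?m +>\<^bsub>?F\<^esub> (add_pow R n \<one>)
      \<and> add_pow R n \<one> \<in> fixed" for n :: nat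
  proof (induction n)
    case 0
    have "\<zero>\<^bsub>?F Quot ?m\<^esub> = ?m +>\<^bsub>?F\<^esub> \<zero>"
      using m.a_rcos_const[of \<zero>] m.zero_closed by (simp add: FactRing_def)
    then show ?case using F.zero_closed by simp
  next
    case (Suc n)
    then show ?case using F.a_closed[of "add_pow R n \<one>" \<one>] F.one_closed
      m.a_rcos_sum[of "add_pow R n \<one>" \<one>]
      by simp (simp add: FactRing_def)
  qed
  ultimately have "add_pow R k \<one> \<in> ?m"
    using m.a_rcos_self[of "add_pow R k \<one>"] by (simp add: FactRing_def)
  then have km: "add_pow R k \<one> \<in> jacobson_radical R" by (simp add: jacobson_radical_fixed)
  obtain l where l: "k = 2 * l + 1"
    using odd_residue_characteristic unfolding k_def[symmetric] by (elim oddE)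
  define c where "c = add_pow R l \<one>"
  have c: "c \<in> carrier R" by (simp add: c_def)
  have "add_pow R k \<one> = (\<one> \<oplus> \<one>) \<otimes> c \<oplus> \<one>"
    using c by (simp add: l c_def mult_2 l_distr flip: add.nat_pow_mult)
  then have "(\<one> \<oplus> \<one>) \<otimes> (\<ominus> c) = \<one> \<ominus> add_pow R k \<one>"
    using c a_lcomm[of \<one> "\<ominus> ((\<one> \<oplus> \<one>) \<otimes> c)" "\<ominus> \<one>"]
    by (simp add: a_minus_def minus_add r_minus r_neg)
  then have u: "(\<one> \<oplus> \<one>) \<otimes> (\<ominus> c) \<in> Units R"
    using one_minus_jacobson_radical_Unit[OF km] by simp
  have "(\<one> \<oplus> \<one>) \<otimes> ((\<ominus> c) \<otimes> inv ((\<one> \<oplus> \<one>) \<otimes> (\<ominus> c))) = \<one>"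
    using u c by (simp del: r_minus flip: m_assoc)
  then show ?thesis using u c by (intro right_inverse_Unit[of "\<one> \<oplus> \<one>"]) auto
qed

definition half :: 'a where "half = inv (\<one> \<oplus> \<one>)"

lemma half_closed [simp]: "half \<in> carrier R"
  by (simp add: half_def two_Unit)

lemma half_fixed: "half \<in> fixed"
proof -
  have "\<one> \<oplus> \<one> \<in> fixed" by (simp add: fixed_points_def star_add)
  then have "\<one> \<oplus> \<one> \<in> Units (fixed_ring R star)" by (simp add: fixed_Units two_Unit)
  then have "inv\<^bsub>fixed_ring R star\<^esub> (\<one> \<oplus> \<one>) \<in> fixed" 
    "(\<one> \<oplus> \<one>) \<otimes> inv\<^bsub>fixed_ring R star\<^esub> (\<one> \<oplus> \<one>) = \<one>"
    using F.Units_inv_closed F.Units_r_inv by auto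
  then show ?thesis using two_Unit fixed_carrier unfolding half_def
    by (metis Units_closed Units_inv_closed Units_l_inv inv_unique)
qed

lemma half_double: "x \<in> carrier R \<Longrightarrow> half \<otimes> (x \<oplus> x) = x"
proof -
  assume x: "x \<in> carrier R"
  have "half \<otimes> (x \<oplus> x) = half \<otimes> (\<one> \<oplus> \<one>) \<otimes> x"
    using x by (simp add: m_assoc l_distr)
  then show ?thesis using x two_Unit by (simp add: half_def)
qed

lemma double_half: "x \<in> carrier R \<Longrightarrow> half \<otimes> x \<oplus> half \<otimes> x = x"
  using half_double by (simp add: r_distr)

text \<open>Otherwise the additive group of the radical would have a subgroup of order 2 by Sylow's theorem,
  although doubling is injective.\<close>

lemma odd_card_jacobson_radical: "odd (card (jacobson_radical R))"
proof
  let ?G = "add_monoid (R\<lparr>carrier := jacobson_radical R\<rparr>)"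
  assume "even (card (jacobson_radical R))"
  then obtain n where n: "card (jacobson_radical R) = 2 ^ 1 * n" by (auto elim: evenE)
  have "group ?G"
    using subgroup.subgroup_is_group[OF J.a_subgroup a_group] by simp
  moreover have "finite (jacobson_radical R)"
    using finite_carrier J.a_subset by (rule rev_finite_subset)
  ultimately obtain H where H: "subgroup H ?G" "card H = 2 ^ 1"
    using sylow_thm[of 2 ?G 1 n] n by (auto simp: order_def)
  interpret H: subgroup H ?G by fact
  have "\<zero> \<in> H" using H.one_closed by simp
  moreover obtain a b where "H = {a, b}" "a \<noteq> b" using H(2) by (auto simp: card_2_iff)
  moreover define x where "x = (if a = \<zero> then b else a)"
  ultimately have x: "x \<in> H" "x \<noteq> \<zero>" and eq: "H = {\<zero>, x}" by auto
  have xc: "x \<in> carrier R" using x(1) H.subset J.a_subset by auto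
  have "x \<oplus> x \<in> H" using H.m_closed[OF x(1) x(1)] by simp
  then have "x \<oplus> x = \<zero> \<or> x \<oplus> x = x" using eq by auto
  then have "x \<oplus> x = \<zero>" using xc x(2) by (metis add.l_cancel_one')
  then have "x = \<zero>" using half_double[OF xc] by simp
  then show False using x(2) by simp
qed

lemma trace_kernel_eq: "trace_kernel R star = {x \<in> jacobson_radical R. x \<oplus> star x = \<zero>}"
  by (simp add: trace_kernel_def a_kernel_def kernel_def)

text \<open>Every radical element is uniquely the sum of a fixed one, namely half its trace, and one of
  trace zero.\<close>

lemma card_jacobson_radical:
  "card (jacobson_radical R)
    = card (jacobson_radical (fixed_ring R star)) * card (trace_kernel R star)"
proof -
  let ?f = "\<lambda>(a, b). a \<oplus> b"
  have "bij_betw ?f (jacobson_radical (fixed_ring R star) \<times> trace_kernel R star) (jacobson_radical R)"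
  proof (rule bij_betw_byWitness[where f' = "\<lambda>x. (half \<otimes> (x \<oplus> star x), x \<ominus> half \<otimes> (x \<oplus> star x))"])
    have "half \<otimes> (x \<oplus> star x) \<in> fixed \<inter> jacobson_radical R"
      "x \<ominus> half \<otimes> (x \<oplus> star x) \<in> trace_kernel R star"
      "half \<otimes> (x \<oplus> star x) \<oplus> (x \<ominus> half \<otimes> (x \<oplus> star x)) = x"
      if x: "x \<in> jacobson_radical R" for x
    proof -
      let ?t = "x \<oplus> star x"
      have xc: "x \<in> carrier R" using x by simp
      have t: "?t \<in> fixed" "?t \<in> jacobson_radical R"
        using x xc by (auto simp: fixed_points_def star_add a_comm)
      have hf: "half \<otimes> ?t \<in> fixed"
        using F.m_closed half_fixed t(1) by simp
      have hJ: "half \<otimes> ?t \<in> jacobson_radical R"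
        using t(2) by (intro J.I_l_closed) auto
      show "half \<otimes> ?t \<in> fixed \<inter> jacobson_radical R" using hf hJ by simp
      define u where "u = half \<otimes> ?t"
      have u: "u \<in> carrier R" "star u = u" "u \<oplus> u = ?t" "u \<in> jacobson_radical R"
        using hf hJ xc by (auto simp: u_def fixed_points_def double_half)
      have "(x \<ominus> u) \<oplus> star (x \<ominus> u) = ?t \<ominus> (u \<oplus> u)"
        using xc u(1,2) by (simp add: a_minus_def star_add star_minus minus_add a_ac)
      also have "\<dots> = \<zero>" using xc u by (simp add: r_right_minus_eq)
      finally show "x \<ominus> half \<otimes> ?t \<in> trace_kernel R star"
        using x u(4) by (simp add: trace_kernel_eq u_def[symmetric] a_minus_def)
      show "half \<otimes> ?t \<oplus> (x \<ominus> half \<otimes> ?t) = x"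
        unfolding u_def[symmetric] using xc u(1) by (simp add: a_minus_def a_lcomm[of u] r_neg)
    qed
    then show "(\<lambda>x. (half \<otimes> (x \<oplus> star x), x \<ominus> half \<otimes> (x \<oplus> star x))) ` jacobson_radical R
      \<subseteq> jacobson_radical (fixed_ring R star) \<times> trace_kernel R star"
      "\<forall>x\<in>jacobson_radical R. ?f (half \<otimes> (x \<oplus> star x), x \<ominus> half \<otimes> (x \<oplus> star x)) = x"
      by (auto simp: jacobson_radical_fixed)
    show "?f ` (jacobson_radical (fixed_ring R star) \<times> trace_kernel R star) \<subseteq> jacobson_radical R"
      by (auto simp: jacobson_radical_fixed trace_kernel_eq)
    show "\<forall>p\<in>jacobson_radical (fixed_ring R star) \<times> trace_kernel R star.
      (half \<otimes> (?f p \<oplus> star (?f p)), ?f p \<ominus> half \<otimes> (?f p \<oplus> star (?f p))) = p"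
    proof clarify
      fix a b assume a: "a \<in> jacobson_radical (fixed_ring R star)" and b: "b \<in> trace_kernel R star"
      have ac: "a \<in> carrier R" "star a = a" and bc: "b \<in> carrier R" "b \<oplus> star b = \<zero>"
        using a b by (auto simp: jacobson_radical_fixed trace_kernel_eq fixed_points_def)
      have "(a \<oplus> b) \<oplus> star (a \<oplus> b) = (a \<oplus> a) \<oplus> (b \<oplus> star b)"
        using ac bc(1) by (simp add: star_add a_ac)
      also have "\<dots> = a \<oplus> a" using ac by (simp add: bc(2))
      finally have "half \<otimes> ((a \<oplus> b) \<oplus> star (a \<oplus> b)) = a" using ac by (simp add: half_double)
      then show "half \<otimes> (a \<oplus> b \<oplus> star (a \<oplus> b)) = a \<and>
        a \<oplus> b \<ominus> half \<otimes> (a \<oplus> b \<oplus> star (a \<oplus> b)) = b"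
        using ac bc(1) by (simp add: a_minus_def a_comm[of a] a_assoc r_neg)
    qed
  qed
  then show ?thesis by (metis bij_betw_same_card card_cartesian_product)
qed

end

section \<open>Finite free modules and Nakayama's lemma\<close>

lemma rmodule_homD:
  assumes "f \<in> rmodule_hom A V W" "v \<in> carrier V"
  shows "f v \<in> carrier W"
    and "w \<in> carrier V \<Longrightarrow> f (v \<oplus>\<^bsub>V\<^esub> w) = f v \<oplus>\<^bsub>W\<^esub> f w"
    and "a \<in> carrier A \<Longrightarrow> f (v \<odot>\<^sub>r\<^bsub>V\<^esub> a) = f v \<odot>\<^sub>r\<^bsub>W\<^esub> a"
  using assms by (auto simp: rmodule_hom_def)

lemma right_module_regular:
  assumes "ring A" shows "right_module A (regular_rmodule A)"
proof -
  interpret ring A by fact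
  have "abelian_group (regular_rmodule A)"
    by (rule abelian_groupI)
      (auto simp: regular_rmodule_def a_ac intro: bexI[of _ "\<ominus>\<^bsub>A\<^esub> _"] l_neg)
  then show ?thesis
    unfolding right_module_def right_module_axioms_def
    by (simp add: assms) (simp add: regular_rmodule_def l_distr r_distr m_assoc)
qed

context right_module
begin

lemma zero_rsmult [simp]: "a \<in> carrier A \<Longrightarrow> \<zero>\<^bsub>V\<^esub> \<odot>\<^sub>r\<^bsub>V\<^esub> a = \<zero>\<^bsub>V\<^esub>"
  by (rule abelian_group_hom.hom_zero[OF rsmult_hom])

lemma rsmult_zero [simp]: "v \<in> carrier V \<Longrightarrow> v \<odot>\<^sub>r\<^bsub>V\<^esub> \<zero>\<^bsub>A\<^esub> = \<zero>\<^bsub>V\<^esub>"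
  using rsmult_r_distr[of v "\<zero>\<^bsub>A\<^esub>" "\<zero>\<^bsub>A\<^esub>"] V.add.l_cancel_one'[of "v \<odot>\<^sub>r\<^bsub>V\<^esub> \<zero>\<^bsub>A\<^esub>" "v \<odot>\<^sub>r\<^bsub>V\<^esub> \<zero>\<^bsub>A\<^esub>"]
  by simp

lemma rsmult_minus_one:
  assumes "v \<in> carrier V" shows "v \<odot>\<^sub>r\<^bsub>V\<^esub> (\<ominus>\<^bsub>A\<^esub> \<one>\<^bsub>A\<^esub>) = \<ominus>\<^bsub>V\<^esub> v"
proof -
  have "v \<odot>\<^sub>r\<^bsub>V\<^esub> (\<ominus>\<^bsub>A\<^esub> \<one>\<^bsub>A\<^esub>) \<oplus>\<^bsub>V\<^esub> v \<odot>\<^sub>r\<^bsub>V\<^esub> \<one>\<^bsub>A\<^esub> = \<zero>\<^bsub>V\<^esub>"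
    using assms by (simp only: rsmult_r_distr[symmetric] A.a_inv_closed A.one_closed A.l_neg rsmult_zero)
  then show ?thesis using assms by (intro V.minus_equality[symmetric]) simp_all
qed

lemma finsum_rsmult:
  assumes "finite I" "f \<in> I \<rightarrow> carrier V" "a \<in> carrier A"
  shows "finsum V f I \<odot>\<^sub>r\<^bsub>V\<^esub> a = finsum V (\<lambda>i. f i \<odot>\<^sub>r\<^bsub>V\<^esub> a) I"
  using assms
proof (induction I rule: finite_induct)
  case empty
  then show ?case by simp
next
  case (insert x F)
  have "finsum V f (insert x F) = f x \<oplus>\<^bsub>V\<^esub> finsum V f F"
    using insert by (intro V.finsum_insert) auto
  moreover have "finsum V (\<lambda>i. f i \<odot>\<^sub>r\<^bsub>V\<^esub> a) (insert x F)
      = f x \<odot>\<^sub>r\<^bsub>V\<^esub> a \<oplus>\<^bsub>V\<^esub> finsum V (\<lambda>i. f i \<odot>\<^sub>r\<^bsub>V\<^esub> a) F"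
    using insert by (intro V.finsum_insert) auto
  moreover have "finsum V f F \<in> carrier V" "f x \<in> carrier V"
    using insert by (auto intro: V.finsum_closed)
  moreover have "finsum V f F \<odot>\<^sub>r\<^bsub>V\<^esub> a = finsum V (\<lambda>i. f i \<odot>\<^sub>r\<^bsub>V\<^esub> a) F"
    using insert by auto
  ultimately show ?case using insert(5) by (simp only: rsmult_l_distr)
qed

lemma rsmult_mem_ideal_multiple:
  "v \<in> carrier V \<Longrightarrow> a \<in> I \<Longrightarrow> v \<odot>\<^sub>r\<^bsub>V\<^esub> a \<in> ideal_multiple V I"
  unfolding ideal_multiple_def by (blast intro: generate.incl)

definition submodule :: "'v set \<Rightarrow> bool" where
  "submodule W \<longleftrightarrow> W \<subseteq> carrier V \<and> \<zero>\<^bsub>V\<^esub> \<in> W \<and> (\<forall>v\<in>W. \<forall>w\<in>W. v \<oplus>\<^bsub>V\<^esub> w \<in> W) \<and>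
     (\<forall>v\<in>W. \<forall>a\<in>carrier A. v \<odot>\<^sub>r\<^bsub>V\<^esub> a \<in> W)"

lemma submodule_extend:
  assumes M: "submodule M" and x: "x \<in> carrier V"
  shows "submodule {v \<oplus>\<^bsub>V\<^esub> x \<odot>\<^sub>r\<^bsub>V\<^esub> a | v a. v \<in> M \<and> a \<in> carrier A}" (is "submodule ?M")
  unfolding submodule_def
proof (intro conjI ballI)
  have Mc: "v \<in> carrier V" if "v \<in> M" for v using M that by (auto simp: submodule_def)
  show "?M \<subseteq> carrier V" using Mc x by auto
  have "\<zero>\<^bsub>V\<^esub> = \<zero>\<^bsub>V\<^esub> \<oplus>\<^bsub>V\<^esub> x \<odot>\<^sub>r\<^bsub>V\<^esub> \<zero>\<^bsub>A\<^esub>" "\<zero>\<^bsub>V\<^esub> \<in> M" using x M by (auto simp: submodule_def)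
  then show "\<zero>\<^bsub>V\<^esub> \<in> ?M" by blast
  fix v assume "v \<in> ?M"
  then obtain v' a where v: "v' \<in> M" "a \<in> carrier A" "v = v' \<oplus>\<^bsub>V\<^esub> x \<odot>\<^sub>r\<^bsub>V\<^esub> a" by (elim CollectE exE conjE)
  {
    fix w assume "w \<in> ?M"
    then obtain w' b where w: "w' \<in> M" "b \<in> carrier A" "w = w' \<oplus>\<^bsub>V\<^esub> x \<odot>\<^sub>r\<^bsub>V\<^esub> b" by (elim CollectE exE conjE)
    have "v \<oplus>\<^bsub>V\<^esub> w = (v' \<oplus>\<^bsub>V\<^esub> w') \<oplus>\<^bsub>V\<^esub> x \<odot>\<^sub>r\<^bsub>V\<^esub> (a \<oplus>\<^bsub>A\<^esub> b)"
      using v w x Mc by (simp add: rsmult_r_distr V.a_ac)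
    moreover have "v' \<oplus>\<^bsub>V\<^esub> w' \<in> M" "a \<oplus>\<^bsub>A\<^esub> b \<in> carrier A" using v w M by (auto simp: submodule_def)
    ultimately show "v \<oplus>\<^bsub>V\<^esub> w \<in> ?M" by blast
  }
  fix b assume b: "b \<in> carrier A"
  have "v \<odot>\<^sub>r\<^bsub>V\<^esub> b = v' \<odot>\<^sub>r\<^bsub>V\<^esub> b \<oplus>\<^bsub>V\<^esub> x \<odot>\<^sub>r\<^bsub>V\<^esub> (a \<otimes>\<^bsub>A\<^esub> b)"
    using v x Mc b by (simp add: rsmult_l_distr rsmult_assoc)
  moreover have "v' \<odot>\<^sub>r\<^bsub>V\<^esub> b \<in> M" "a \<otimes>\<^bsub>A\<^esub> b \<in> carrier A" using v M b by (auto simp: submodule_def)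
  ultimately show "v \<odot>\<^sub>r\<^bsub>V\<^esub> b \<in> ?M" by blast
qed

text \<open>Suppose \<open>W + VJ = V\<close> and let \<open>M \<noteq> V\<close> be a maximal submodule containing \<open>W\<close>. For \<open>x \<notin> M\<close> the
  submodule \<open>M + xA\<close> is \<open>V\<close>, so \<open>VJ \<subseteq> M + xJ\<close>. Hence \<open>x = y + xj\<close> with \<open>y \<in> M\<close>
  and \<open>j \<in> J\<close>, and \<open>x (1 - j) \<in> M\<close> forces \<open>x \<in> M\<close>.\<close>

lemma nakayama:
  assumes A: "finite_ring A" and fin: "finite (carrier V)" and W: "submodule W"
    and sum: "\<And>v. v \<in> carrier V \<Longrightarrow>
      \<exists>w\<in>W. \<exists>n\<in>ideal_multiple V (jacobson_radical A). v = w \<oplus>\<^bsub>V\<^esub> n"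
  shows "W = carrier V"
proof (rule ccontr)
  interpret A: finite_ring A by fact
  let ?J = "jacobson_radical A"
  interpret J: ideal ?J A by (rule A.jacobson_radical_ideal)
  assume "W \<noteq> carrier V"
  let ?S = "{M. submodule M \<and> W \<subseteq> M \<and> M \<noteq> carrier V}"
  have "?S \<subseteq> Pow (carrier V)" by (auto simp: submodule_def)
  then have "finite ?S" by (rule finite_subset) (simp add: fin)
  moreover have "W \<in> ?S" using W \<open>W \<noteq> carrier V\<close> by simp
  ultimately obtain M where M: "submodule M" "W \<subseteq> M" "M \<noteq> carrier V"
    and max: "\<And>M'. submodule M' \<Longrightarrow> M \<subseteq> M' \<Longrightarrow> M' \<noteq> M \<Longrightarrow> M' = carrier V"
    using finite_has_maximal2[of ?S W] by (smt (verit) mem_Collect_eq subset_trans)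
  have Mc: "v \<in> carrier V" if "v \<in> M" for v using M(1) that by (auto simp: submodule_def)
  have Madd: "v \<oplus>\<^bsub>V\<^esub> w \<in> M" if "v \<in> M" "w \<in> M" for v w using M(1) that by (auto simp: submodule_def)
  have Msm: "v \<odot>\<^sub>r\<^bsub>V\<^esub> a \<in> M" if "v \<in> M" "a \<in> carrier A" for v a
    using M(1) that by (auto simp: submodule_def)
  have Mzero: "\<zero>\<^bsub>V\<^esub> \<in> M" using M(1) by (auto simp: submodule_def)
  obtain x where x: "x \<in> carrier V" "x \<notin> M" using M Mc by blast
  let ?M = "{v \<oplus>\<^bsub>V\<^esub> x \<odot>\<^sub>r\<^bsub>V\<^esub> a | v a. v \<in> M \<and> a \<in> carrier A}"
  have "M \<subseteq> ?M"
  proof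
    fix v assume v: "v \<in> M"
    then have "v = v \<oplus>\<^bsub>V\<^esub> x \<odot>\<^sub>r\<^bsub>V\<^esub> \<zero>\<^bsub>A\<^esub>" using x Mc by simp
    then show "v \<in> ?M" using v A.zero_closed by blast
  qed
  moreover have "x \<in> ?M"
  proof -
    have "x = \<zero>\<^bsub>V\<^esub> \<oplus>\<^bsub>V\<^esub> x \<odot>\<^sub>r\<^bsub>V\<^esub> \<one>\<^bsub>A\<^esub>" using x by simp
    then show ?thesis using Mzero A.one_closed by blast
  qed
  ultimately have M': "?M = carrier V"
    using max[OF submodule_extend[OF M(1) x(1)]] x(2) by blast
  have N: "\<exists>v\<in>M. \<exists>j\<in>?J. n = v \<oplus>\<^bsub>V\<^esub> x \<odot>\<^sub>r\<^bsub>V\<^esub> j" if "n \<in> ideal_multiple V ?J" for n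
  proof (rule ideal_multiple_induct[OF A.jacobson_radical_ideal that])
    fix v a assume v: "v \<in> carrier V" and a: "a \<in> ?J"
    have ac: "a \<in> carrier A" using a by (rule A.jacobson_radical_carrier)
    from v M' obtain w b where w: "w \<in> M" "b \<in> carrier A" "v = w \<oplus>\<^bsub>V\<^esub> x \<odot>\<^sub>r\<^bsub>V\<^esub> b"
      by (smt (verit) mem_Collect_eq)
    then have "v \<odot>\<^sub>r\<^bsub>V\<^esub> a = w \<odot>\<^sub>r\<^bsub>V\<^esub> a \<oplus>\<^bsub>V\<^esub> x \<odot>\<^sub>r\<^bsub>V\<^esub> (b \<otimes>\<^bsub>A\<^esub> a)"
      using x(1) Mc ac by (simp add: rsmult_l_distr rsmult_assoc)
    then show "\<exists>w\<in>M. \<exists>j\<in>?J. v \<odot>\<^sub>r\<^bsub>V\<^esub> a = w \<oplus>\<^bsub>V\<^esub> x \<odot>\<^sub>r\<^bsub>V\<^esub> j"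
      using Msm[OF w(1) ac] J.I_l_closed[OF a w(2)] by blast
  next
    have "\<zero>\<^bsub>V\<^esub> = \<zero>\<^bsub>V\<^esub> \<oplus>\<^bsub>V\<^esub> x \<odot>\<^sub>r\<^bsub>V\<^esub> \<zero>\<^bsub>A\<^esub>" using x(1) by simp
    then show "\<exists>v\<in>M. \<exists>j\<in>?J. \<zero>\<^bsub>V\<^esub> = v \<oplus>\<^bsub>V\<^esub> x \<odot>\<^sub>r\<^bsub>V\<^esub> j" using Mzero J.zero_closed by blast
  next
    fix v assume v: "v \<in> carrier V" "\<exists>w\<in>M. \<exists>j\<in>?J. v = w \<oplus>\<^bsub>V\<^esub> x \<odot>\<^sub>r\<^bsub>V\<^esub> j"
    then obtain w j where w: "w \<in> M" "j \<in> ?J" "v = w \<oplus>\<^bsub>V\<^esub> x \<odot>\<^sub>r\<^bsub>V\<^esub> j" by blast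
    have jc: "j \<in> carrier A" using w(2) by (rule A.jacobson_radical_carrier)
    have "\<ominus>\<^bsub>V\<^esub> v = v \<odot>\<^sub>r\<^bsub>V\<^esub> (\<ominus>\<^bsub>A\<^esub> \<one>\<^bsub>A\<^esub>)" using v by (simp add: rsmult_minus_one)
    also have "\<dots> = w \<odot>\<^sub>r\<^bsub>V\<^esub> (\<ominus>\<^bsub>A\<^esub> \<one>\<^bsub>A\<^esub>) \<oplus>\<^bsub>V\<^esub> x \<odot>\<^sub>r\<^bsub>V\<^esub> (j \<otimes>\<^bsub>A\<^esub> (\<ominus>\<^bsub>A\<^esub> \<one>\<^bsub>A\<^esub>))"
      using w x(1) Mc jc by (simp add: rsmult_l_distr rsmult_assoc[symmetric] del: A.r_minus)
    finally show "\<exists>w\<in>M. \<exists>j\<in>?J. \<ominus>\<^bsub>V\<^esub> v = w \<oplus>\<^bsub>V\<^esub> x \<odot>\<^sub>r\<^bsub>V\<^esub> j"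
      using Msm[OF w(1), of "\<ominus>\<^bsub>A\<^esub> \<one>\<^bsub>A\<^esub>"] J.I_r_closed[OF w(2), of "\<ominus>\<^bsub>A\<^esub> \<one>\<^bsub>A\<^esub>"] by blast
  next
    fix v v' assume "\<exists>w\<in>M. \<exists>j\<in>?J. v = w \<oplus>\<^bsub>V\<^esub> x \<odot>\<^sub>r\<^bsub>V\<^esub> j"
      "\<exists>w\<in>M. \<exists>j\<in>?J. v' = w \<oplus>\<^bsub>V\<^esub> x \<odot>\<^sub>r\<^bsub>V\<^esub> j"
    then obtain w j w' j' where w: "w \<in> M" "j \<in> ?J" "v = w \<oplus>\<^bsub>V\<^esub> x \<odot>\<^sub>r\<^bsub>V\<^esub> j"
      "w' \<in> M" "j' \<in> ?J" "v' = w' \<oplus>\<^bsub>V\<^esub> x \<odot>\<^sub>r\<^bsub>V\<^esub> j'" by (elim bexE)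
    have jc: "j \<in> carrier A" "j' \<in> carrier A" using w(2,5) by (auto intro: A.jacobson_radical_carrier)
    have "v \<oplus>\<^bsub>V\<^esub> v' = (w \<oplus>\<^bsub>V\<^esub> w') \<oplus>\<^bsub>V\<^esub> x \<odot>\<^sub>r\<^bsub>V\<^esub> (j \<oplus>\<^bsub>A\<^esub> j')"
      using w x(1) Mc jc by (simp add: rsmult_r_distr V.a_ac)
    then show "\<exists>w\<in>M. \<exists>j\<in>?J. v \<oplus>\<^bsub>V\<^esub> v' = w \<oplus>\<^bsub>V\<^esub> x \<odot>\<^sub>r\<^bsub>V\<^esub> j"
      using Madd[OF w(1,4)] J.a_closed[OF w(2,5)] by blast
  qed
  obtain w n where w: "w \<in> W" and n: "n \<in> ideal_multiple V ?J" "x = w \<oplus>\<^bsub>V\<^esub> n"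
    using sum[OF x(1)] by blast
  obtain v j where v: "v \<in> M" and j: "j \<in> ?J" and nv: "n = v \<oplus>\<^bsub>V\<^esub> x \<odot>\<^sub>r\<^bsub>V\<^esub> j"
    using N[OF n(1)] by blast
  have jc: "j \<in> carrier A" using j by (rule A.jacobson_radical_carrier)
  have wv: "w \<oplus>\<^bsub>V\<^esub> v \<in> M" using M(2) w v by (auto intro: Madd)
  have xeq: "x = (w \<oplus>\<^bsub>V\<^esub> v) \<oplus>\<^bsub>V\<^esub> x \<odot>\<^sub>r\<^bsub>V\<^esub> j"
    unfolding V.a_assoc[OF Mc[OF subsetD[OF M(2) w]] Mc[OF v] rsmult_closed[OF x(1) jc]]
    using n(2) nv by simp
  have u: "\<one>\<^bsub>A\<^esub> \<ominus>\<^bsub>A\<^esub> j \<in> Units A" using j by (rule A.one_minus_jacobson_radical_Unit)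
  have eq: "x \<odot>\<^sub>r\<^bsub>V\<^esub> (\<one>\<^bsub>A\<^esub> \<ominus>\<^bsub>A\<^esub> j) \<oplus>\<^bsub>V\<^esub> x \<odot>\<^sub>r\<^bsub>V\<^esub> j = x"
    using x(1) jc by (simp add: rsmult_r_distr[symmetric] a_minus_def A.a_assoc A.l_neg)
  have "x \<odot>\<^sub>r\<^bsub>V\<^esub> (\<one>\<^bsub>A\<^esub> \<ominus>\<^bsub>A\<^esub> j) = w \<oplus>\<^bsub>V\<^esub> v"
    using eq xeq Mc[OF wv] x(1) jc by (metis V.add.right_cancel rsmult_closed A.minus_closed A.one_closed)
  then have "(x \<odot>\<^sub>r\<^bsub>V\<^esub> (\<one>\<^bsub>A\<^esub> \<ominus>\<^bsub>A\<^esub> j)) \<odot>\<^sub>r\<^bsub>V\<^esub> inv\<^bsub>A\<^esub> (\<one>\<^bsub>A\<^esub> \<ominus>\<^bsub>A\<^esub> j) \<in> M"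
    using Msm wv u by simp
  then have "x \<in> M"
    using x(1) u by (simp only: rsmult_assoc[symmetric] A.Units_closed A.Units_inv_closed
      A.Units_r_inv rsmult_one)
  then show False using x(2) by simp
qed

text \<open>By Nakayama's lemma the image is everything; on a finite set, onto implies bijective.\<close>

lemma bij_if_surj_mod_radical:
  assumes A: "finite_ring A" and fin: "finite (carrier V)" and g: "g \<in> rmodule_hom A V V"
    and surj: "\<And>v. v \<in> carrier V \<Longrightarrow>
      \<exists>w\<in>carrier V. \<exists>n\<in>ideal_multiple V (jacobson_radical A). v = g w \<oplus>\<^bsub>V\<^esub> n"
  shows "bij_betw g (carrier V) (carrier V)"
proof -
  note gD = rmodule_homD[OF g]
  have "g \<zero>\<^bsub>V\<^esub> = \<zero>\<^bsub>V\<^esub>"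
    using gD(3)[OF V.zero_closed A.zero_closed] gD(1)[OF V.zero_closed] by simp
  then have "\<zero>\<^bsub>V\<^esub> \<in> g ` carrier V" by (metis V.zero_closed imageI)
  moreover have "v \<oplus>\<^bsub>V\<^esub> w \<in> g ` carrier V" if "v \<in> g ` carrier V" "w \<in> g ` carrier V" for v w
    using that by (elim imageE) (simp add: gD(2)[symmetric])
  moreover have "v \<odot>\<^sub>r\<^bsub>V\<^esub> a \<in> g ` carrier V" if "v \<in> g ` carrier V" "a \<in> carrier A" for v a
    using that gD(3) by (auto intro!: image_eqI[of _ g "_ \<odot>\<^sub>r\<^bsub>V\<^esub> _"])
  ultimately have "submodule (g ` carrier V)"
    using gD(1) unfolding submodule_def by blast
  then have "g ` carrier V = carrier V"
    using surj by (intro nakayama[OF A fin]) blast+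
  then show ?thesis
    using fin by (simp add: bij_betw_def eq_card_imp_inj_on)
qed

end

section \<open>Coordinates in a free module\<close>

locale free_module = right_module A V
  for A :: "('a, 'r) ring_scheme" (structure) and V :: "('a, 'v, 's) rmodule_scheme" (structure) +
  fixes e :: "nat \<Rightarrow> 'v" and m :: nat
  assumes basis_closed: "e \<in> {..<m} \<rightarrow> carrier V"
    and basis: "v \<in> carrier V \<Longrightarrow>
      \<exists>!c. c \<in> {..<m} \<rightarrow>\<^sub>E carrier A \<and> v = finsum V (\<lambda>i. e i \<odot>\<^sub>r\<^bsub>V\<^esub> c i) {..<m}"
begin

lemma e_closed [simp]: "i < m \<Longrightarrow> e i \<in> carrier V"
  using basis_closed by auto

definition coord :: "'v \<Rightarrow> nat \<Rightarrow> 'a" where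
  "coord v = (THE c. c \<in> {..<m} \<rightarrow>\<^sub>E carrier A \<and> v = finsum V (\<lambda>i. e i \<odot>\<^sub>r\<^bsub>V\<^esub> c i) {..<m})"

lemma
  assumes "v \<in> carrier V"
  shows coord_closed [simp]: "i < m \<Longrightarrow> coord v i \<in> carrier A"
    and coord_sum: "finsum V (\<lambda>i. e i \<odot>\<^sub>r\<^bsub>V\<^esub> coord v i) {..<m} = v"
  using theI'[OF basis[OF assms]] unfolding coord_def[symmetric] by auto

lemma coord_eqI:
  assumes c: "\<And>i. i < m \<Longrightarrow> c i \<in> carrier A" and i: "i < m"
  shows "coord (finsum V (\<lambda>i. e i \<odot>\<^sub>r\<^bsub>V\<^esub> c i) {..<m}) i = c i"
proof -
  let ?v = "finsum V (\<lambda>i. e i \<odot>\<^sub>r\<^bsub>V\<^esub> c i) {..<m}"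
  have "?v \<in> carrier V" using c by (intro V.finsum_closed) auto
  moreover have "?v = finsum V (\<lambda>i. e i \<odot>\<^sub>r\<^bsub>V\<^esub> restrict c {..<m} i) {..<m}"
    using c by (intro V.finsum_cong') auto
  ultimately have "coord ?v = restrict c {..<m}"
    unfolding coord_def using c by (intro the1_equality basis) auto
  then show ?thesis using i by simp
qed

lemma coord_add:
  assumes v: "v \<in> carrier V" and w: "w \<in> carrier V" and i: "i < m"
  shows "coord (v \<oplus>\<^bsub>V\<^esub> w) i = coord v i \<oplus>\<^bsub>A\<^esub> coord w i"
proof -
  have "finsum V (\<lambda>i. e i \<odot>\<^sub>r\<^bsub>V\<^esub> (coord v i \<oplus>\<^bsub>A\<^esub> coord w i)) {..<m}
      = finsum V (\<lambda>i. e i \<odot>\<^sub>r\<^bsub>V\<^esub> coord v i \<oplus>\<^bsub>V\<^esub> e i \<odot>\<^sub>r\<^bsub>V\<^esub> coord w i) {..<m}"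
    using v w by (intro V.finsum_cong') (auto simp: rsmult_r_distr)
  also have "\<dots> = v \<oplus>\<^bsub>V\<^esub> w"
    using v w by (subst V.finsum_addf) (auto simp: coord_sum)
  finally show ?thesis
    using coord_eqI[of "\<lambda>i. coord v i \<oplus>\<^bsub>A\<^esub> coord w i"] v w i by simp
qed

lemma coord_rsmult:
  assumes v: "v \<in> carrier V" and a: "a \<in> carrier A" and i: "i < m"
  shows "coord (v \<odot>\<^sub>r\<^bsub>V\<^esub> a) i = coord v i \<otimes>\<^bsub>A\<^esub> a"
proof -
  have "finsum V (\<lambda>i. e i \<odot>\<^sub>r\<^bsub>V\<^esub> (coord v i \<otimes>\<^bsub>A\<^esub> a)) {..<m}
      = finsum V (\<lambda>i. e i \<odot>\<^sub>r\<^bsub>V\<^esub> coord v i \<odot>\<^sub>r\<^bsub>V\<^esub> a) {..<m}"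
    using v a by (intro V.finsum_cong') (auto simp: rsmult_assoc)
  also have "\<dots> = v \<odot>\<^sub>r\<^bsub>V\<^esub> a"
    using v a by (subst finsum_rsmult[symmetric]) (auto simp: coord_sum)
  finally show ?thesis
    using coord_eqI[of "\<lambda>i. coord v i \<otimes>\<^bsub>A\<^esub> a"] v a i by simp
qed

lemma coord_basis:
  assumes i: "i < m" and j: "j < m"
  shows "coord (e j) i = (if i = j then \<one>\<^bsub>A\<^esub> else \<zero>\<^bsub>A\<^esub>)"
proof -
  have "finsum V (\<lambda>i. e i \<odot>\<^sub>r\<^bsub>V\<^esub> (if i = j then \<one>\<^bsub>A\<^esub> else \<zero>\<^bsub>A\<^esub>)) {..<m}
      = finsum V (\<lambda>i. if j = i then e i else \<zero>\<^bsub>V\<^esub>) {..<m}"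
    by (intro V.finsum_cong') auto
  also have "\<dots> = e j" using j by (subst V.finsum_singleton) auto
  finally show ?thesis
    using coord_eqI[of "\<lambda>i. if i = j then \<one>\<^bsub>A\<^esub> else \<zero>\<^bsub>A\<^esub>" i] i by simp
qed

lemma coord_ideal_multiple:
  assumes I: "ideal I A" and n: "n \<in> ideal_multiple V I" and i: "i < m"
  shows "coord n i \<in> I"
proof -
  interpret I: ideal I A by fact
  show ?thesis
  proof (rule ideal_multiple_induct[OF I n])
    fix v a assume v: "v \<in> carrier V" and a: "a \<in> I"
    show "coord (v \<odot>\<^sub>r\<^bsub>V\<^esub> a) i \<in> I"
      unfolding coord_rsmult[OF v I.a_Hcarr[OF a] i]
      by (rule I.I_l_closed[OF a coord_closed[OF v i]])
  next
    have "coord \<zero>\<^bsub>V\<^esub> i = coord \<zero>\<^bsub>V\<^esub> i \<otimes>\<^bsub>A\<^esub> \<zero>\<^bsub>A\<^esub>"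
      using coord_rsmult[of "\<zero>\<^bsub>V\<^esub>" "\<zero>\<^bsub>A\<^esub>" i] i by simp
    also have "\<dots> = \<zero>\<^bsub>A\<^esub>" using i by simp
    finally show "coord \<zero>\<^bsub>V\<^esub> i \<in> I" by simp
  next
    fix v assume v: "v \<in> carrier V" "coord v i \<in> I"
    have "coord (\<ominus>\<^bsub>V\<^esub> v) i = coord v i \<otimes>\<^bsub>A\<^esub> (\<ominus>\<^bsub>A\<^esub> \<one>\<^bsub>A\<^esub>)"
      using v i by (simp only: rsmult_minus_one[symmetric] coord_rsmult A.a_inv_closed A.one_closed)
    then show "coord (\<ominus>\<^bsub>V\<^esub> v) i \<in> I"
      using I.I_r_closed[OF v(2), of "\<ominus>\<^bsub>A\<^esub> \<one>\<^bsub>A\<^esub>"] by simp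
  next
    fix v w assume "v \<in> carrier V" "w \<in> carrier V" "coord v i \<in> I" "coord w i \<in> I"
    then show "coord (v \<oplus>\<^bsub>V\<^esub> w) i \<in> I" using i by (simp add: coord_add)
  qed
qed

lemma finsum_mem_ideal_multiple:
  assumes I: "ideal I A" and c: "c \<in> {..<m} \<rightarrow> I"
  shows "finsum V (\<lambda>i. e i \<odot>\<^sub>r\<^bsub>V\<^esub> c i) {..<m} \<in> ideal_multiple V I"
proof -
  interpret I: ideal I A by fact
  interpret N: abelian_subgroup "ideal_multiple V I" V
    by (rule ideal_multiple_abelian_subgroup[OF I])
  have "finsum V (\<lambda>i. e i \<odot>\<^sub>r\<^bsub>V\<^esub> c i) F \<in> ideal_multiple V I" if "F \<subseteq> {..<m}" for F
    using finite_subset[OF that finite_lessThan] that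
  proof (induction F rule: finite_induct)
    case (insert i F)
    then have "e i \<odot>\<^sub>r\<^bsub>V\<^esub> c i \<in> ideal_multiple V I"
      using c by (intro rsmult_mem_ideal_multiple) auto
    moreover have "finsum V (\<lambda>i. e i \<odot>\<^sub>r\<^bsub>V\<^esub> c i) (insert i F)
        = e i \<odot>\<^sub>r\<^bsub>V\<^esub> c i \<oplus>\<^bsub>V\<^esub> finsum V (\<lambda>i. e i \<odot>\<^sub>r\<^bsub>V\<^esub> c i) F"
      using insert c I.a_subset by (intro V.finsum_insert) (auto intro!: rsmult_closed)
    ultimately show ?case using insert by simp
  qed simp
  then show ?thesis by simp
qed

lemma ideal_multiple_iff_coord:
  assumes I: "ideal I A" and v: "v \<in> carrier V"
  shows "v \<in> ideal_multiple V I \<longleftrightarrow> (\<forall>i<m. coord v i \<in> I)"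
  using coord_ideal_multiple[OF I, of v] finsum_mem_ideal_multiple[OF I, of "coord v"] coord_sum[OF v]
  by auto

lemma card_submodule_coord:
  assumes S: "S \<subseteq> carrier A"
  shows "card {v \<in> carrier V. \<forall>i<m. coord v i \<in> S} = card S ^ m"
proof -
  have "bij_betw (\<lambda>v. \<lambda>i\<in>{..<m}. coord v i) {v \<in> carrier V. \<forall>i<m. coord v i \<in> S} ({..<m} \<rightarrow>\<^sub>E S)"
  proof (rule bij_betw_byWitness[where f' = "\<lambda>c. finsum V (\<lambda>i. e i \<odot>\<^sub>r\<^bsub>V\<^esub> c i) {..<m}"])
    show "\<forall>v\<in>{v \<in> carrier V. \<forall>i<m. coord v i \<in> S}.
      finsum V (\<lambda>i. e i \<odot>\<^sub>r\<^bsub>V\<^esub> (\<lambda>i\<in>{..<m}. coord v i) i) {..<m} = v"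
    proof
      fix v assume "v \<in> {v \<in> carrier V. \<forall>i<m. coord v i \<in> S}"
      then have v: "v \<in> carrier V" by simp
      have "finsum V (\<lambda>i. e i \<odot>\<^sub>r\<^bsub>V\<^esub> (\<lambda>i\<in>{..<m}. coord v i) i) {..<m}
        = finsum V (\<lambda>i. e i \<odot>\<^sub>r\<^bsub>V\<^esub> coord v i) {..<m}"
        using v by (intro V.finsum_cong') auto
      then show "finsum V (\<lambda>i. e i \<odot>\<^sub>r\<^bsub>V\<^esub> (\<lambda>i\<in>{..<m}. coord v i) i) {..<m} = v"
        using coord_sum[OF v] by simp
    qed
    show "\<forall>c\<in>{..<m} \<rightarrow>\<^sub>E S. (\<lambda>i\<in>{..<m}. coord (finsum V (\<lambda>i. e i \<odot>\<^sub>r\<^bsub>V\<^esub> c i) {..<m}) i) = c"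
    proof
      fix c assume c: "c \<in> {..<m} \<rightarrow>\<^sub>E S"
      then have "c i \<in> carrier A" if "i < m" for i using S that by auto
      then show "(\<lambda>i\<in>{..<m}. coord (finsum V (\<lambda>i. e i \<odot>\<^sub>r\<^bsub>V\<^esub> c i) {..<m}) i) = c"
        using c by (intro extensionalityI[of _ "{..<m}"]) (auto simp: coord_eqI PiE_def)
    qed
    show "(\<lambda>v. \<lambda>i\<in>{..<m}. coord v i) ` {v \<in> carrier V. \<forall>i<m. coord v i \<in> S} \<subseteq> {..<m} \<rightarrow>\<^sub>E S"
      by (simp add: image_subset_iff restrict_PiE_iff)
    show "(\<lambda>c. finsum V (\<lambda>i. e i \<odot>\<^sub>r\<^bsub>V\<^esub> c i) {..<m}) ` ({..<m} \<rightarrow>\<^sub>E S)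
      \<subseteq> {v \<in> carrier V. \<forall>i<m. coord v i \<in> S}"
    proof clarify
      fix c assume c: "c \<in> {..<m} \<rightarrow>\<^sub>E S"
      then have cc: "c i \<in> carrier A" if "i < m" for i using S that by auto
      then have "finsum V (\<lambda>i. e i \<odot>\<^sub>r\<^bsub>V\<^esub> c i) {..<m} \<in> carrier V"
        by (intro V.finsum_closed) auto
      then show "finsum V (\<lambda>i. e i \<odot>\<^sub>r\<^bsub>V\<^esub> c i) {..<m} \<in> carrier V \<and>
        (\<forall>i<m. coord (finsum V (\<lambda>i. e i \<odot>\<^sub>r\<^bsub>V\<^esub> c i) {..<m}) i \<in> S)"
        using c coord_eqI[OF cc] by auto
    qed
  qed
  then have "card {v \<in> carrier V. \<forall>i<m. coord v i \<in> S} = card ({..<m} \<rightarrow>\<^sub>E S)"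
    by (rule bij_betw_same_card)
  then show ?thesis by (simp add: card_PiE)
qed

lemma card_ideal_multiple:
  assumes I: "ideal I A" shows "card (ideal_multiple V I) = card I ^ m"
proof -
  interpret I: ideal I A by fact
  interpret N: abelian_subgroup "ideal_multiple V I" V
    by (rule ideal_multiple_abelian_subgroup[OF I])
  have "ideal_multiple V I = {v \<in> carrier V. \<forall>i<m. coord v i \<in> I}"
    using ideal_multiple_iff_coord[OF I] N.a_subset by blast
  then show ?thesis by (simp only: card_submodule_coord[OF I.a_subset])
qed

lemma finite_carrier_if_finite_scalars:
  assumes "finite (carrier A)" shows "finite (carrier V)"
proof -
  have "carrier V \<subseteq> (\<lambda>c. finsum V (\<lambda>i. e i \<odot>\<^sub>r\<^bsub>V\<^esub> c i) {..<m}) ` ({..<m} \<rightarrow>\<^sub>E carrier A)"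
    using basis by blast
  then show ?thesis
    by (rule finite_subset) (simp add: assms finite_PiE)
qed

text \<open>Identities between linear expressions are proved by this rule rather than by expanding in
  coordinates.\<close>

lemma basis_induct:
  assumes v: "v \<in> carrier V" and zero: "P \<zero>\<^bsub>V\<^esub>" and basis: "\<And>i. i < m \<Longrightarrow> P (e i)"
    and add: "\<And>v w. v \<in> carrier V \<Longrightarrow> w \<in> carrier V \<Longrightarrow> P v \<Longrightarrow> P w \<Longrightarrow> P (v \<oplus>\<^bsub>V\<^esub> w)"
    and rsmult: "\<And>v a. v \<in> carrier V \<Longrightarrow> a \<in> carrier A \<Longrightarrow> P v \<Longrightarrow> P (v \<odot>\<^sub>r\<^bsub>V\<^esub> a)"
  shows "P v"
proof -
  have "P (finsum V (\<lambda>i. e i \<odot>\<^sub>r\<^bsub>V\<^esub> coord v i) F)" if "F \<subseteq> {..<m}" for F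
    using finite_subset[OF that finite_lessThan] that
  proof (induction F rule: finite_induct)
    case (insert i F)
    then have "finsum V (\<lambda>i. e i \<odot>\<^sub>r\<^bsub>V\<^esub> coord v i) (insert i F)
        = e i \<odot>\<^sub>r\<^bsub>V\<^esub> coord v i \<oplus>\<^bsub>V\<^esub> finsum V (\<lambda>i. e i \<odot>\<^sub>r\<^bsub>V\<^esub> coord v i) F"
      using v by (intro V.finsum_insert) auto
    moreover have "finsum V (\<lambda>i. e i \<odot>\<^sub>r\<^bsub>V\<^esub> coord v i) F \<in> carrier V"
      using insert v by (intro V.finsum_closed) auto
    moreover have "P (e i \<odot>\<^sub>r\<^bsub>V\<^esub> coord v i)"
      using insert v by (simp add: rsmult basis)
    ultimately show ?case using insert v by (simp add: add)
  qed (simp add: zero)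
  then show ?thesis using coord_sum[OF v] by force
qed

lemma rmodule_hom_eqI:
  assumes W: "right_module A W" and f: "f \<in> rmodule_hom A V W" and g: "g \<in> rmodule_hom A V W"
    and eq: "\<And>i. i < m \<Longrightarrow> f (e i) = g (e i)" and v: "v \<in> carrier V"
  shows "f v = g v"
proof -
  interpret W: right_module A W by fact
  have zero: "k \<zero>\<^bsub>V\<^esub> = \<zero>\<^bsub>W\<^esub>" if "k \<in> rmodule_hom A V W" for k
    using rmodule_homD(1,3)[OF that V.zero_closed] A.zero_closed by (metis W.rsmult_zero zero_rsmult)
  show ?thesis
    by (rule basis_induct[OF v]) (simp_all add: zero eq f g rmodule_homD[OF f] rmodule_homD[OF g])
qed

definition lin_ext :: "('a, 'w, 't) rmodule_scheme \<Rightarrow> (nat \<Rightarrow> 'w) \<Rightarrow> 'v \<Rightarrow> 'w" where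
  "lin_ext W y = (\<lambda>v\<in>carrier V. finsum W (\<lambda>i. y i \<odot>\<^sub>r\<^bsub>W\<^esub> coord v i) {..<m})"

lemma
  assumes W: "right_module A W" and y: "y \<in> {..<m} \<rightarrow> carrier W"
  shows lin_ext_hom: "lin_ext W y \<in> rmodule_hom A V W"
    and lin_ext_basis: "i < m \<Longrightarrow> lin_ext W y (e i) = y i"
proof -
  interpret W: right_module A W by fact
  have y': "y i \<in> carrier W" if "i < m" for i using y that by auto
  show "lin_ext W y \<in> rmodule_hom A V W"
    unfolding rmodule_hom_def
  proof (intro CollectI conjI ballI)
    show "lin_ext W y \<in> carrier V \<rightarrow> carrier W"
      using y' by (auto simp: lin_ext_def intro!: W.finsum_closed)
    fix v assume v: "v \<in> carrier V"
    {
      fix w assume w: "w \<in> carrier V"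
      have "finsum W (\<lambda>i. y i \<odot>\<^sub>r\<^bsub>W\<^esub> coord (v \<oplus>\<^bsub>V\<^esub> w) i) {..<m}
        = finsum W (\<lambda>i. y i \<odot>\<^sub>r\<^bsub>W\<^esub> coord v i \<oplus>\<^bsub>W\<^esub> y i \<odot>\<^sub>r\<^bsub>W\<^esub> coord w i) {..<m}"
        using v w y' by (intro W.finsum_cong') (auto simp: coord_add W.rsmult_r_distr)
      also have "\<dots> = finsum W (\<lambda>i. y i \<odot>\<^sub>r\<^bsub>W\<^esub> coord v i) {..<m}
          \<oplus>\<^bsub>W\<^esub> finsum W (\<lambda>i. y i \<odot>\<^sub>r\<^bsub>W\<^esub> coord w i) {..<m}"
        using v w y' by (intro W.finsum_addf) auto
      finally show "lin_ext W y (v \<oplus>\<^bsub>V\<^esub> w) = lin_ext W y v \<oplus>\<^bsub>W\<^esub> lin_ext W y w"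
        using v w by (simp add: lin_ext_def)
    }
    fix a assume a: "a \<in> carrier A"
    have "finsum W (\<lambda>i. y i \<odot>\<^sub>r\<^bsub>W\<^esub> coord (v \<odot>\<^sub>r\<^bsub>V\<^esub> a) i) {..<m}
        = finsum W (\<lambda>i. y i \<odot>\<^sub>r\<^bsub>W\<^esub> coord v i \<odot>\<^sub>r\<^bsub>W\<^esub> a) {..<m}"
      using v a y' by (intro W.finsum_cong') (auto simp: coord_rsmult W.rsmult_assoc)
    also have "\<dots> = finsum W (\<lambda>i. y i \<odot>\<^sub>r\<^bsub>W\<^esub> coord v i) {..<m} \<odot>\<^sub>r\<^bsub>W\<^esub> a"
      using v a y' by (intro W.finsum_rsmult[symmetric]) auto
    finally show "lin_ext W y (v \<odot>\<^sub>r\<^bsub>V\<^esub> a) = lin_ext W y v \<odot>\<^sub>r\<^bsub>W\<^esub> a"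
      using v a by (simp add: lin_ext_def)
  qed
  assume i: "i < m"
  have "finsum W (\<lambda>j. y j \<odot>\<^sub>r\<^bsub>W\<^esub> coord (e i) j) {..<m}
      = finsum W (\<lambda>j. if i = j then y j else \<zero>\<^bsub>W\<^esub>) {..<m}"
    using i y' by (intro W.finsum_cong') (auto simp: coord_basis)
  also have "\<dots> = y i" using i y' by (subst W.finsum_singleton) auto
  finally show "lin_ext W y (e i) = y i" using i by (simp add: lin_ext_def)
qed

lemma lin_ext_extensional: "lin_ext W y \<in> extensional (carrier V)"
  by (simp add: lin_ext_def)

end

section \<open>Reduction of linear maps modulo an ideal\<close>

locale module_with_ideal = right_module A V + I: ideal I A
  for A :: "('a, 'r) ring_scheme" (structure) and V :: "('a, 'v, 's) rmodule_scheme" (structure)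
    and I :: "'a set"
begin

abbreviation N :: "'v set" where "N \<equiv> ideal_multiple V I"
abbreviation Vbar :: "('a set, 'v set) rmodule" where "Vbar \<equiv> reduced_rmodule V I"

lemma ideal_I: "ideal I A"
  by (rule I.ideal_axioms)

sublocale N: abelian_subgroup N V
  by (rule ideal_multiple_abelian_subgroup[OF ideal_I])

lemma coset_self: "v \<in> carrier V \<Longrightarrow> v \<in> N +>\<^bsub>V\<^esub> v"
  by (rule N.a_rcos_self)

lemma coset_eqI: "x \<in> N +>\<^bsub>V\<^esub> v \<Longrightarrow> v \<in> carrier V \<Longrightarrow> N +>\<^bsub>V\<^esub> x = N +>\<^bsub>V\<^esub> v"
  using N.a_repr_independence' by metis

lemma coset_closed: "x \<in> N +>\<^bsub>V\<^esub> v \<Longrightarrow> v \<in> carrier V \<Longrightarrow> x \<in> carrier V"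
  by (rule N.a_elemrcos_carrier)

lemma coset_eq_iff:
  assumes "v \<in> carrier V" "w \<in> carrier V"
  shows "N +>\<^bsub>V\<^esub> v = N +>\<^bsub>V\<^esub> w \<longleftrightarrow> (\<exists>n\<in>N. v = w \<oplus>\<^bsub>V\<^esub> n)"
proof
  assume "N +>\<^bsub>V\<^esub> v = N +>\<^bsub>V\<^esub> w"
  then have "v \<in> N +>\<^bsub>V\<^esub> w" using coset_self assms by blast
  then obtain n where n: "n \<in> N" "v = n \<oplus>\<^bsub>V\<^esub> w" by (auto simp: a_r_coset_def')
  then show "\<exists>n\<in>N. v = w \<oplus>\<^bsub>V\<^esub> n" using assms V.a_comm N.a_Hcarr by metis
next
  assume "\<exists>n\<in>N. v = w \<oplus>\<^bsub>V\<^esub> n"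
  then obtain n where n: "n \<in> N" "v = n \<oplus>\<^bsub>V\<^esub> w" using assms V.a_comm N.a_Hcarr by metis
  then show "N +>\<^bsub>V\<^esub> v = N +>\<^bsub>V\<^esub> w"
    using assms by (intro coset_eqI) (auto simp: a_r_coset_def')
qed

lemma carrier_Vbar: "carrier Vbar = (\<lambda>v. N +>\<^bsub>V\<^esub> v) ` carrier V"
  by (auto simp: reduced_rmodule_def A_RCOSETS_def')

lemma carrier_Quot: "carrier (A Quot I) = (\<lambda>a. I +>\<^bsub>A\<^esub> a) ` carrier A"
  by (auto simp: FactRing_def A_RCOSETS_def')

lemma Vbar_add:
  "v \<in> carrier V \<Longrightarrow> w \<in> carrier V \<Longrightarrow>
    (N +>\<^bsub>V\<^esub> v) \<oplus>\<^bsub>Vbar\<^esub> (N +>\<^bsub>V\<^esub> w) = N +>\<^bsub>V\<^esub> (v \<oplus>\<^bsub>V\<^esub> w)"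
  by (simp add: reduced_rmodule_def N.a_rcos_sum)

lemmas Vbar_rsmult = reduced_smult_coset[OF ideal_I]

definition endo :: "('v \<Rightarrow> 'v) set" where
  "endo = rmodule_hom A V V \<inter> extensional (carrier V)"

definition endo_bar :: "('v set \<Rightarrow> 'v set) set" where
  "endo_bar = rmodule_hom (A Quot I) Vbar Vbar \<inter> extensional (carrier Vbar)"

text \<open>As for the reduced form, the union runs over all representatives of a coset, and its members coincide if
  \<open>g\<close> is linear (\<open>red_coset\<close>).\<close>

definition red :: "('v \<Rightarrow> 'v) \<Rightarrow> 'v set \<Rightarrow> 'v set" where
  "red g = (\<lambda>C\<in>carrier Vbar. \<Union>v\<in>C. N +>\<^bsub>V\<^esub> g v)"

lemma endoD:
  assumes "g \<in> endo" "v \<in> carrier V"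
  shows "g v \<in> carrier V"
    and "w \<in> carrier V \<Longrightarrow> g (v \<oplus>\<^bsub>V\<^esub> w) = g v \<oplus>\<^bsub>V\<^esub> g w"
    and "a \<in> carrier A \<Longrightarrow> g (v \<odot>\<^sub>r\<^bsub>V\<^esub> a) = g v \<odot>\<^sub>r\<^bsub>V\<^esub> a"
  using assms by (auto simp: endo_def rmodule_hom_def)

lemma endo_zero: "g \<in> endo \<Longrightarrow> g \<zero>\<^bsub>V\<^esub> = \<zero>\<^bsub>V\<^esub>"
  using endoD(1)[of g "\<zero>\<^bsub>V\<^esub>"] endoD(3)[of g "\<zero>\<^bsub>V\<^esub>" "\<zero>\<^bsub>A\<^esub>"] V.zero_closed A.zero_closed
  by (metis zero_rsmult rsmult_zero)

lemma endo_minus: "g \<in> endo \<Longrightarrow> v \<in> carrier V \<Longrightarrow> g (\<ominus>\<^bsub>V\<^esub> v) = \<ominus>\<^bsub>V\<^esub> g v"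
  using endoD(1)[of g v] endoD(3)[of g v "\<ominus>\<^bsub>A\<^esub> \<one>\<^bsub>A\<^esub>"] by (simp add: rsmult_minus_one)

lemma endo_ideal_multiple:
  assumes g: "g \<in> endo" and n: "n \<in> N" shows "g n \<in> N"
proof (rule ideal_multiple_induct[OF ideal_I n])
  fix v a assume "v \<in> carrier V" "a \<in> I"
  then show "g (v \<odot>\<^sub>r\<^bsub>V\<^esub> a) \<in> N"
    using endoD[OF g] rsmult_mem_ideal_multiple I.a_Hcarr by simp
qed (simp_all add: endo_zero[OF g] endo_minus[OF g] endoD[OF g])

lemma red_coset:
  assumes g: "g \<in> endo" and v: "v \<in> carrier V"
  shows "red g (N +>\<^bsub>V\<^esub> v) = N +>\<^bsub>V\<^esub> g v"
proof -
  have eq: "N +>\<^bsub>V\<^esub> g x = N +>\<^bsub>V\<^esub> g v" if x: "x \<in> N +>\<^bsub>V\<^esub> v" for x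
  proof -
    have xc: "x \<in> carrier V" using x v by (rule coset_closed)
    obtain n where n: "n \<in> N" "x = v \<oplus>\<^bsub>V\<^esub> n"
      using coset_eqI[OF x v] coset_eq_iff[OF xc v] by blast
    have "g x = g v \<oplus>\<^bsub>V\<^esub> g n" using n v endoD(2)[OF g] N.a_Hcarr by simp
    then show ?thesis
      using coset_eq_iff endoD(1)[OF g] xc v endo_ideal_multiple[OF g n(1)] by blast
  qed
  have "N +>\<^bsub>V\<^esub> v \<in> carrier Vbar" "N +>\<^bsub>V\<^esub> v \<noteq> {}"
    using v coset_self[OF v] by (auto simp: carrier_Vbar)
  then show ?thesis
    by (simp add: red_def eq cong: SUP_cong)
qed

lemma endo_barD:
  assumes "\<phi> \<in> endo_bar" "v \<in> carrier V"
  shows "\<phi> (N +>\<^bsub>V\<^esub> v) \<in> carrier Vbar"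
    and "w \<in> carrier V \<Longrightarrow>
      \<phi> (N +>\<^bsub>V\<^esub> (v \<oplus>\<^bsub>V\<^esub> w)) = \<phi> (N +>\<^bsub>V\<^esub> v) \<oplus>\<^bsub>Vbar\<^esub> \<phi> (N +>\<^bsub>V\<^esub> w)"
    and "a \<in> carrier A \<Longrightarrow>
      \<phi> (N +>\<^bsub>V\<^esub> (v \<odot>\<^sub>r\<^bsub>V\<^esub> a)) = \<phi> (N +>\<^bsub>V\<^esub> v) \<odot>\<^sub>r\<^bsub>Vbar\<^esub> (I +>\<^bsub>A\<^esub> a)"
  using assms
  by (auto simp: endo_bar_def rmodule_hom_def carrier_Vbar carrier_Quot simp flip: Vbar_add Vbar_rsmult)

lemma red_endo_bar: assumes g: "g \<in> endo" shows "red g \<in> endo_bar"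
  unfolding endo_bar_def rmodule_hom_def
proof (intro IntI CollectI conjI ballI)
  show "red g \<in> extensional (carrier Vbar)" by (simp add: red_def)
  show "red g \<in> carrier Vbar \<rightarrow> carrier Vbar"
    using endoD(1)[OF g] by (auto simp: carrier_Vbar red_coset[OF g])
  fix C assume "C \<in> carrier Vbar"
  then obtain v where v: "v \<in> carrier V" "C = N +>\<^bsub>V\<^esub> v" by (auto simp: carrier_Vbar)
  show "red g (C \<oplus>\<^bsub>Vbar\<^esub> D) = red g C \<oplus>\<^bsub>Vbar\<^esub> red g D" if "D \<in> carrier Vbar" for D
    using that v by (auto simp: carrier_Vbar Vbar_add red_coset[OF g] endoD[OF g])
  show "red g (C \<odot>\<^sub>r\<^bsub>Vbar\<^esub> D) = red g C \<odot>\<^sub>r\<^bsub>Vbar\<^esub> D" if "D \<in> carrier (A Quot I)" for D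
    using that v by (auto simp: carrier_Quot Vbar_rsmult red_coset[OF g] endoD[OF g])
qed

lemma endo_bar_eqI:
  assumes "\<phi> \<in> endo_bar" "\<psi> \<in> endo_bar"
    "\<And>v. v \<in> carrier V \<Longrightarrow> \<phi> (N +>\<^bsub>V\<^esub> v) = \<psi> (N +>\<^bsub>V\<^esub> v)"
  shows "\<phi> = \<psi>"
  using assms by (intro extensionalityI[of _ "carrier Vbar"]) (auto simp: endo_bar_def carrier_Vbar)

end

locale free_module_with_ideal = free_module A V e m + module_with_ideal A V I
  for A :: "('a, 'r) ring_scheme" (structure) and V :: "('a, 'v, 's) rmodule_scheme" (structure)
    and e m and I :: "'a set"
begin

lemma red_eqI:
  assumes g: "g \<in> endo" and \<phi>: "\<phi> \<in> endo_bar"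
    and eq: "\<And>i. i < m \<Longrightarrow> N +>\<^bsub>V\<^esub> g (e i) = \<phi> (N +>\<^bsub>V\<^esub> e i)"
  shows "red g = \<phi>"
proof (rule endo_bar_eqI[OF red_endo_bar[OF g] \<phi>])
  fix v assume v: "v \<in> carrier V"
  show "red g (N +>\<^bsub>V\<^esub> v) = \<phi> (N +>\<^bsub>V\<^esub> v)"
  proof (rule basis_induct[OF v])
    have "\<psi> (N +>\<^bsub>V\<^esub> \<zero>\<^bsub>V\<^esub>) = N +>\<^bsub>V\<^esub> \<zero>\<^bsub>V\<^esub>" if \<psi>: "\<psi> \<in> endo_bar" for \<psi>
    proof -
      obtain x where x: "x \<in> carrier V" "\<psi> (N +>\<^bsub>V\<^esub> \<zero>\<^bsub>V\<^esub>) = N +>\<^bsub>V\<^esub> x"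
        using endo_barD(1)[OF \<psi> V.zero_closed] by (auto simp: carrier_Vbar)
      then show ?thesis
        using endo_barD(3)[OF \<psi> V.zero_closed A.zero_closed] Vbar_rsmult[OF x(1) A.zero_closed]
        by simp
    qed
    from this[OF red_endo_bar[OF g]] this[OF \<phi>]
    show "red g (N +>\<^bsub>V\<^esub> \<zero>\<^bsub>V\<^esub>) = \<phi> (N +>\<^bsub>V\<^esub> \<zero>\<^bsub>V\<^esub>)" by (simp only:)
    show "red g (N +>\<^bsub>V\<^esub> e i) = \<phi> (N +>\<^bsub>V\<^esub> e i)" if "i < m" for i
      using that by (simp add: red_coset[OF g] eq)
  qed (simp_all add: endo_barD[OF red_endo_bar[OF g]] endo_barD[OF \<phi>])
qed

text \<open>A lift of \<open>\<phi>\<close> is determined by the images of the basis vectors \<open>e\<^sub>i\<close>, and these may be any elements of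
  the cosets \<open>\<phi> (N + e\<^sub>i)\<close>.\<close>

lemma card_red_fibre:
  assumes \<phi>: "\<phi> \<in> endo_bar"
  shows "card {g \<in> endo. red g = \<phi>} = card N ^ m"
proof -
  let ?T = "PiE {..<m} (\<lambda>i. \<phi> (N +>\<^bsub>V\<^esub> e i))"
  have "bij_betw (\<lambda>g. \<lambda>i\<in>{..<m}. g (e i)) {g \<in> endo. red g = \<phi>} ?T"
  proof (rule bij_betw_byWitness[where f' = "lin_ext V"])
    have cl: "y \<in> {..<m} \<rightarrow> carrier V" "\<And>i. i < m \<Longrightarrow> N +>\<^bsub>V\<^esub> y i = \<phi> (N +>\<^bsub>V\<^esub> e i)" if y: "y \<in> ?T" for y
    proof -
      have "y i \<in> carrier V \<and> N +>\<^bsub>V\<^esub> y i = \<phi> (N +>\<^bsub>V\<^esub> e i)" if i: "i < m" for i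
      proof -
        obtain x where x: "x \<in> carrier V" "\<phi> (N +>\<^bsub>V\<^esub> e i) = N +>\<^bsub>V\<^esub> x"
          using endo_barD(1)[OF \<phi> e_closed[OF i]] by (auto simp: carrier_Vbar)
        then have "y i \<in> N +>\<^bsub>V\<^esub> x" using y i by auto
        from coset_eqI[OF this x(1)] coset_closed[OF this x(1)] show ?thesis by (simp only: x(2))
      qed
      then show "y \<in> {..<m} \<rightarrow> carrier V" "\<And>i. i < m \<Longrightarrow> N +>\<^bsub>V\<^esub> y i = \<phi> (N +>\<^bsub>V\<^esub> e i)"
        by auto
    qed
    have le: "lin_ext V y \<in> endo" if "y \<in> {..<m} \<rightarrow> carrier V" for y
      using lin_ext_hom[OF right_module_axioms that] lin_ext_extensional by (simp add: endo_def)
    show "\<forall>g\<in>{g \<in> endo. red g = \<phi>}. lin_ext V (\<lambda>i\<in>{..<m}. g (e i)) = g"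
    proof clarify
      fix g assume g: "g \<in> endo"
      have y: "(\<lambda>i\<in>{..<m}. g (e i)) \<in> {..<m} \<rightarrow> carrier V" using endoD(1)[OF g] by auto
      show "lin_ext V (\<lambda>i\<in>{..<m}. g (e i)) = g"
      proof (rule extensionalityI[of _ "carrier V"])
        fix v assume v: "v \<in> carrier V"
        show "lin_ext V (\<lambda>i\<in>{..<m}. g (e i)) v = g v"
          using right_module_axioms lin_ext_hom[OF right_module_axioms y] _ _ v
          by (rule rmodule_hom_eqI) (use g lin_ext_basis[OF right_module_axioms y] in \<open>auto simp: endo_def\<close>)
      qed (use g in \<open>auto simp: endo_def lin_ext_extensional\<close>)
    qed
    show "\<forall>y\<in>?T. (\<lambda>i\<in>{..<m}. lin_ext V y (e i)) = y"
    proof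
      fix y assume y: "y \<in> ?T"
      show "(\<lambda>i\<in>{..<m}. lin_ext V y (e i)) = y"
        using y lin_ext_basis[OF right_module_axioms cl(1)[OF y]]
        by (intro extensionalityI[of _ "{..<m}"]) (auto simp: PiE_def)
    qed
    show "(\<lambda>g. \<lambda>i\<in>{..<m}. g (e i)) ` {g \<in> endo. red g = \<phi>} \<subseteq> ?T"
      by (auto simp: image_subset_iff restrict_PiE_iff red_coset coset_self endoD(1))
    show "lin_ext V ` ?T \<subseteq> {g \<in> endo. red g = \<phi>}"
    proof clarify
      fix y assume y: "y \<in> ?T"
      show "lin_ext V y \<in> endo \<and> red (lin_ext V y) = \<phi>"
        using red_eqI[OF le \<phi>] lin_ext_basis[OF right_module_axioms cl(1)[OF y]] cl[OF y] le by simp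
    qed
  qed
  then have "card {g \<in> endo. red g = \<phi>} = card ?T" by (rule bij_betw_same_card)
  also have "\<dots> = (\<Prod>i<m. card (\<phi> (N +>\<^bsub>V\<^esub> e i)))" by (simp add: card_PiE)
  also have "\<dots> = (\<Prod>i<m. card N)"
  proof (intro prod.cong refl)
    fix i assume "i \<in> {..<m}"
    then have "\<phi> (N +>\<^bsub>V\<^esub> e i) \<in> carrier Vbar" by (intro endo_barD(1)[OF \<phi>]) simp
    then show "card (\<phi> (N +>\<^bsub>V\<^esub> e i)) = card N"
      by (intro V.add.card_rcosets_equal[symmetric] N.a_subset) (simp add: reduced_rmodule_def A_RCOSETS_defs(1))
  qed
  finally show ?thesis by simp
qed

lemma red_bij_iff:
  assumes A: "finite_ring A" and I: "I = jacobson_radical A" and g: "g \<in> endo"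
  shows "bij_betw (red g) (carrier Vbar) (carrier Vbar) \<longleftrightarrow> bij_betw g (carrier V) (carrier V)"
proof
  interpret A: finite_ring A by fact
  have fin: "finite (carrier V)" by (rule finite_carrier_if_finite_scalars[OF A.finite_carrier])
  {
    assume bij: "bij_betw (red g) (carrier Vbar) (carrier Vbar)"
    show "bij_betw g (carrier V) (carrier V)"
    proof (rule bij_if_surj_mod_radical[OF A fin])
      show "g \<in> rmodule_hom A V V" using g by (simp add: endo_def)
      fix v assume v: "v \<in> carrier V"
      then have "N +>\<^bsub>V\<^esub> v \<in> red g ` carrier Vbar"
        using bij by (auto simp: bij_betw_def carrier_Vbar)
      then obtain w where w: "w \<in> carrier V" "N +>\<^bsub>V\<^esub> v = red g (N +>\<^bsub>V\<^esub> w)"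
        by (auto simp: carrier_Vbar)
      then have "N +>\<^bsub>V\<^esub> v = N +>\<^bsub>V\<^esub> g w" by (simp add: red_coset[OF g])
      then show "\<exists>w\<in>carrier V. \<exists>n\<in>ideal_multiple V (jacobson_radical A). v = g w \<oplus>\<^bsub>V\<^esub> n"
        using coset_eq_iff[OF v endoD(1)[OF g w(1)]] w(1) unfolding I by blast
    qed
  next
    assume bij: "bij_betw g (carrier V) (carrier V)"
    have "red g ` carrier Vbar = (\<lambda>v. N +>\<^bsub>V\<^esub> v) ` g ` carrier V"
      by (simp add: carrier_Vbar image_image red_coset[OF g])
    also have "\<dots> = carrier Vbar" using bij by (simp add: bij_betw_def carrier_Vbar)
    finally have "red g ` carrier Vbar = carrier Vbar" .
    moreover have "finite (carrier Vbar)" using fin by (simp add: carrier_Vbar)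
    ultimately show "bij_betw (red g) (carrier Vbar) (carrier Vbar)"
      by (simp add: bij_betw_def eq_card_imp_inj_on)
  }
qed

end

section \<open>Isometries modulo the radical\<close>

lemma card_eq_mult_card_fibre:
  assumes "finite S" "finite T" "f \<in> S \<rightarrow> T" "\<And>t. t \<in> T \<Longrightarrow> card {s \<in> S. f s = t} = k"
  shows "card S = card T * k"
proof -
  have "card S = (\<Sum>t\<in>T. card {s \<in> S. f s = t})"
      using sum.group[OF assms(1,2) funcset_image[OF assms(3)], of "\<lambda>_. 1::nat"] by simp
  then show ?thesis by (simp add: assms(4))
qed

locale hermitian_module =
  A?: involutive_local_ring A star + free_module_with_ideal A V e m "jacobson_radical A"
  for A :: "('a, 'r) ring_scheme" (structure) and V :: "('a, 'v, 's) rmodule_scheme" (structure)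
    and star e m +
  fixes h :: "'v \<Rightarrow> 'v \<Rightarrow> 'a"
  assumes hermitian: "hermitian_form A star V h" and nondegenerate: "nondegenerate A star V h"
begin

abbreviation (input) JA :: "'a set" where "JA \<equiv> jacobson_radical A"

lemma finite_V: "finite (carrier V)"
  by (rule finite_carrier_if_finite_scalars[OF finite_carrier])

lemma finite_endo: "finite endo"
proof (rule finite_subset)
  show "endo \<subseteq> carrier V \<rightarrow>\<^sub>E carrier V" by (auto simp: endo_def rmodule_hom_def PiE_def)
  show "finite (carrier V \<rightarrow>\<^sub>E carrier V)" using finite_V by (simp add: finite_PiE)
qed

lemmas h_closed [simp] = hermitian_formD(1)[OF hermitian]
lemmas h_add_left = hermitian_formD(2)[OF hermitian]
lemmas h_add_right = hermitian_formD(3)[OF hermitian]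
lemmas h_rsmult = hermitian_formD(4)[OF hermitian]
lemmas h_star = hermitian_formD(5)[OF hermitian]

lemma reduced_form_coset_JA:
  "v \<in> carrier V \<Longrightarrow> w \<in> carrier V \<Longrightarrow>
    reduced_form A JA h (N +>\<^bsub>V\<^esub> v) (N +>\<^bsub>V\<^esub> w) = JA +>\<^bsub>A\<^esub> h v w"
  by (rule reduced_form_coset[OF ideal_I _ hermitian]) auto

definition near_isometries :: "('v \<Rightarrow> 'v) set" where
  "near_isometries = {g \<in> endo. bij_betw g (carrier V) (carrier V) \<and>
     (\<forall>v\<in>carrier V. \<forall>w\<in>carrier V. JA +>\<^bsub>A\<^esub> h (g v) (g w) = JA +>\<^bsub>A\<^esub> h v w)}"

definition isometries :: "('v \<Rightarrow> 'v) set" where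
  "isometries = {g \<in> endo. bij_betw g (carrier V) (carrier V) \<and>
     (\<forall>v\<in>carrier V. \<forall>w\<in>carrier V. h (g v) (g w) = h v w)}"

abbreviation (input) Ubar where
  "Ubar \<equiv> unitary_group (A Quot JA) Vbar (reduced_form A JA h)"

lemma order_unitary_group: "order (unitary_group A V h) = card isometries"
proof -
  have "carrier (unitary_group A V h) = isometries"
    by (auto simp: unitary_group_def isometries_def Bij_def rmodule_iso_def endo_def)
  then show ?thesis by (simp add: order_def)
qed

lemma carrier_Ubar:
  "carrier Ubar = {\<phi> \<in> endo_bar. bij_betw \<phi> (carrier Vbar) (carrier Vbar) \<and>
     (\<forall>C\<in>carrier Vbar. \<forall>D\<in>carrier Vbar.
       reduced_form A JA h (\<phi> C) (\<phi> D) = reduced_form A JA h C D)}"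
  by (auto simp: unitary_group_def Bij_def rmodule_iso_def endo_bar_def)

text \<open>This is where Nakayama's lemma enters the count: bijectivity, like the condition on the form, can be
  tested after reduction.\<close>

lemma near_isometry_iff_red:
  assumes g: "g \<in> endo"
  shows "g \<in> near_isometries \<longleftrightarrow> red g \<in> carrier Ubar"
  using g red_bij_iff[OF finite_ring_axioms refl g] red_endo_bar[OF g]
  by (simp add: near_isometries_def carrier_Ubar)
    (simp add: carrier_Vbar red_coset[OF g] reduced_form_coset_JA endoD[OF g])

lemma card_near_isometries_by_reduction:
  "card near_isometries = order Ubar * card N ^ m"
  unfolding order_def
proof (rule card_eq_mult_card_fibre[where f = red])
  show "finite near_isometries"
    using finite_endo by (rule rev_finite_subset) (auto simp: near_isometries_def)
  have "finite (carrier Vbar \<rightarrow>\<^sub>E carrier Vbar)"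
    using finite_V by (simp add: finite_PiE carrier_Vbar)
  then show "finite (carrier Ubar)"
    by (rule rev_finite_subset) (auto simp: carrier_Ubar endo_bar_def rmodule_hom_def PiE_def)
  show "red \<in> near_isometries \<rightarrow> carrier Ubar"
    using near_isometry_iff_red by (auto simp: near_isometries_def)
  fix \<phi> assume \<phi>: "\<phi> \<in> carrier Ubar"
  have "{g \<in> near_isometries. red g = \<phi>} = {g \<in> endo. red g = \<phi>}"
    using \<phi> near_isometry_iff_red by (auto simp: near_isometries_def)
  then show "card {g \<in> near_isometries. red g = \<phi>} = card N ^ m"
    using card_red_fibre[of \<phi>] \<phi> by (simp add: carrier_Ubar)
qed


section \<open>Gram matrices\<close>

lemma id_endo: "(\<lambda>v\<in>carrier V. v) \<in> endo"
  by (auto simp: endo_def rmodule_hom_def)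

lemma compose_endo:
  assumes f: "f \<in> endo" and g: "g \<in> endo" shows "compose (carrier V) f g \<in> endo"
  unfolding endo_def rmodule_hom_def
  by (intro IntI CollectI conjI ballI Pi_I)
    (simp_all add: compose_eq endoD[OF f] endoD[OF g])

lemma inverse_endo:
  assumes g: "g \<in> endo" and bij: "bij_betw g (carrier V) (carrier V)"
    and k: "k = (\<lambda>v\<in>carrier V. inv_into (carrier V) g v)"
  shows "k \<in> endo"
    and "v \<in> carrier V \<Longrightarrow> g (k v) = v"
    and "v \<in> carrier V \<Longrightarrow> k (g v) = v"
    and "bij_betw k (carrier V) (carrier V)"
proof -
  have inj: "inj_on g (carrier V)" and im: "g ` carrier V = carrier V"
    using bij by (auto simp: bij_betw_def)
  have kc: "k v \<in> carrier V" if "v \<in> carrier V" for v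
    using that im by (simp add: k inv_into_into)
  have gk: "g (k v) = v" if "v \<in> carrier V" for v
    using that im by (simp add: k f_inv_into_f)
  have kg: "k (g v) = v" if "v \<in> carrier V" for v
    using that inj endoD(1)[OF g] by (simp add: k inv_into_f_f)
  show "v \<in> carrier V \<Longrightarrow> g (k v) = v" "v \<in> carrier V \<Longrightarrow> k (g v) = v"
    by (fact gk, fact kg)
  show "bij_betw k (carrier V) (carrier V)"
    using bij_betw_inv_into[OF bij] by (simp add: k bij_betw_restrict_eq)
  have "k (v \<oplus>\<^bsub>V\<^esub> w) = k v \<oplus>\<^bsub>V\<^esub> k w" if vw: "v \<in> carrier V" "w \<in> carrier V" for v w
  proof -
    have "v \<oplus>\<^bsub>V\<^esub> w = g (k v \<oplus>\<^bsub>V\<^esub> k w)"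
      by (simp only: endoD(2)[OF g kc[OF vw(1)] kc[OF vw(2)]] gk[OF vw(1)] gk[OF vw(2)])
    then show ?thesis using kg[OF V.a_closed[OF kc[OF vw(1)] kc[OF vw(2)]]] by simp
  qed
  moreover have "k (v \<odot>\<^sub>r\<^bsub>V\<^esub> a) = k v \<odot>\<^sub>r\<^bsub>V\<^esub> a" if va: "v \<in> carrier V" "a \<in> carrier A" for v a
  proof -
    have "v \<odot>\<^sub>r\<^bsub>V\<^esub> a = g (k v \<odot>\<^sub>r\<^bsub>V\<^esub> a)"
      by (simp only: endoD(3)[OF g kc[OF va(1)] va(2)] gk[OF va(1)])
    then show ?thesis using kg[OF rsmult_closed[OF kc[OF va(1)] va(2)]] by simp
  qed
  moreover have "k \<in> extensional (carrier V)" by (simp add: k)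
  ultimately show "k \<in> endo"
    using kc unfolding endo_def rmodule_hom_def by (intro IntI CollectI conjI ballI Pi_I) simp_all
qed

text \<open>The form is linear in its second argument and, by hermitian symmetry, the first argument can
  be brought there.\<close>

lemma form_eq_if_eq_on_basis:
  assumes f: "f \<in> endo" "f' \<in> endo" "g \<in> endo" "g' \<in> endo"
    and eq: "\<And>i j. i < m \<Longrightarrow> j < m \<Longrightarrow> h (f (e i)) (f' (e j)) = h (g (e i)) (g' (e j))"
    and v: "v \<in> carrier V" and w: "w \<in> carrier V"
  shows "h (f v) (f' w) = h (g v) (g' w)"
proof -
  have hom: "(\<lambda>w. h u (k w)) \<in> rmodule_hom A V (regular_rmodule A)"
    if "u \<in> carrier V" "k \<in> endo" for u k
    using that endoD[OF that(2)]
    by (auto simp: rmodule_hom_def regular_rmodule_def h_add_right h_rsmult)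
  have reg: "right_module A (regular_rmodule A)"
    by (rule right_module_regular) (rule A.ring_axioms)
  have 1: "h (f (e i)) (f' w) = h (g (e i)) (g' w)" if i: "i < m" for i
    by (rule rmodule_hom_eqI[OF reg hom hom _ w]) (simp_all add: i eq f endoD(1)[OF f(1)] endoD(1)[OF f(3)])
  have "h (f' w) (f v) = h (g' w) (g v)"
  proof (rule rmodule_hom_eqI[OF reg hom hom _ v])
    fix i assume i: "i < m"
    then show "h (f' w) (f (e i)) = h (g' w) (g (e i))"
      using 1[OF i] w by (simp only: h_star[of "f (e i)" "f' w"] h_star[of "g (e i)" "g' w"] f endoD(1) e_closed)
  qed (use w f endoD(1) in auto)
  then show ?thesis
    using v w by (simp only: h_star[of "f' w" "f v"] h_star[of "g' w" "g v"] f endoD(1))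
qed

text \<open>A hermitian matrix is recorded by its entries on and below the diagonal, which are subject
  to no relation other than that the diagonal is fixed by the involution.\<close>

definition lower :: "(nat \<times> nat) set" where "lower = (SIGMA i:{..<m}. {..i})"

definition gram :: "('v \<Rightarrow> 'v) \<Rightarrow> nat \<times> nat \<Rightarrow> 'a" where
  "gram g = (\<lambda>(i, j)\<in>lower. h (g (e i)) (g (e j)))"

definition gram_range :: "(nat \<times> nat \<Rightarrow> 'a) set" where
  "gram_range = (PiE lower (\<lambda>(i, j).
     if i = j then fixed \<inter> (JA +>\<^bsub>A\<^esub> h (e i) (e j)) else JA +>\<^bsub>A\<^esub> h (e i) (e j)))"

lemma form_eq_if_gram_eq:
  assumes f: "f \<in> endo" and g: "g \<in> endo" and eq: "gram f = gram g"
    and v: "v \<in> carrier V" and w: "w \<in> carrier V"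
  shows "h (f v) (f w) = h (g v) (g w)"
proof (rule form_eq_if_eq_on_basis[OF f f g g _ v w])
  fix i j assume i: "i < m" and j: "j < m"
  have *: "h (f (e i)) (f (e j)) = h (g (e i)) (g (e j))" if "j \<le> i" "i < m" for i j
    using that fun_cong[OF eq, of "(i, j)"] by (simp add: gram_def lower_def)
  show "h (f (e i)) (f (e j)) = h (g (e i)) (g (e j))"
  proof (cases "j \<le> i")
    case True then show ?thesis using * i by simp
  next
    case False
    then have "h (f (e j)) (f (e i)) = h (g (e j)) (g (e i))" using * j by simp
    then show ?thesis
      using i j by (simp only: h_star[of "f (e j)" "f (e i)"] h_star[of "g (e j)" "g (e i)"] f g endoD(1) e_closed)
  qed
qed

lemma gram_mem_range: "g \<in> near_isometries \<Longrightarrow> gram g \<in> gram_range"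
proof -
  assume g: "g \<in> near_isometries"
  then have ge: "g \<in> endo" by (simp add: near_isometries_def)
  have gc: "g (e i) \<in> carrier V" if "i < m" for i using that endoD(1)[OF ge] by simp
  have "h (g (e i)) (g (e j)) \<in> JA +>\<^bsub>A\<^esub> h (e i) (e j)" if "i < m" "j < m" for i j
  proof -
    have "h (g (e i)) (g (e j)) \<in> JA +>\<^bsub>A\<^esub> h (g (e i)) (g (e j))"
      using gc that by (intro J.a_rcos_self) simp
    then show ?thesis using g that by (simp add: near_isometries_def)
  qed
  moreover have "h (g (e i)) (g (e i)) \<in> fixed" if "i < m" for i
    using gc[OF that] h_star[of "g (e i)" "g (e i)"] by (simp add: fixed_points_def)
  ultimately show ?thesis
    unfolding gram_range_def gram_def by (auto simp: lower_def restrict_PiE_iff)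
qed

text \<open>If \<open>g\<close> and \<open>g0\<close> have the same Gram matrix, then \<open>g\<close> composed with the inverse of
  \<open>g0\<close> is an isometry.\<close>

lemma card_gram_fibre:
  assumes g0: "g0 \<in> near_isometries"
  shows "card {g \<in> near_isometries. gram g = gram g0} = card isometries"
proof -
  have g0e: "g0 \<in> endo" and g0b: "bij_betw g0 (carrier V) (carrier V)"
    using g0 by (auto simp: near_isometries_def)
  define k where "k = (\<lambda>v\<in>carrier V. inv_into (carrier V) g0 v)"
  note k = inverse_endo[OF g0e g0b k_def]
  note kc = endoD(1)[OF k(1)]
  have ext: "g \<in> endo \<Longrightarrow> g \<in> extensional (carrier V)" for g by (simp add: endo_def)
  have "bij_betw (\<lambda>u. compose (carrier V) u g0) isometries {g \<in> near_isometries. gram g = gram g0}"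
  proof (rule bij_betw_byWitness[where f' = "\<lambda>g. compose (carrier V) g k"])
    show "\<forall>u\<in>isometries. compose (carrier V) (compose (carrier V) u g0) k = u"
    proof
      fix u assume "u \<in> isometries"
      then have u: "u \<in> extensional (carrier V)" by (simp add: isometries_def ext)
      show "compose (carrier V) (compose (carrier V) u g0) k = u"
        by (rule extensionalityI[OF compose_extensional u]) (simp add: compose_eq kc k(2))
    qed
    show "\<forall>g\<in>{g \<in> near_isometries. gram g = gram g0}.
        compose (carrier V) (compose (carrier V) g k) g0 = g"
    proof
      fix g assume "g \<in> {g \<in> near_isometries. gram g = gram g0}"
      then have g: "g \<in> extensional (carrier V)" by (simp add: near_isometries_def ext)
      show "compose (carrier V) (compose (carrier V) g k) g0 = g"
        by (rule extensionalityI[OF compose_extensional g]) (simp add: compose_eq endoD(1)[OF g0e] k(3))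
    qed
    show "(\<lambda>u. compose (carrier V) u g0) ` isometries \<subseteq> {g \<in> near_isometries. gram g = gram g0}"
    proof clarify
      fix u assume u: "u \<in> isometries"
      then have uh: "h (u v) (u w) = h v w" if "v \<in> carrier V" "w \<in> carrier V" for v w
        using that by (auto simp: isometries_def)
      let ?g = "compose (carrier V) u g0"
      have "?g \<in> endo" using u g0e by (intro compose_endo) (simp_all add: isometries_def)
      moreover have "bij_betw ?g (carrier V) (carrier V)"
        using u by (intro bij_betw_compose[OF g0b]) (simp add: isometries_def)
      moreover have hg: "h (?g v) (?g w) = h (g0 v) (g0 w)"
        if "v \<in> carrier V" "w \<in> carrier V" for v w
        using that uh endoD(1)[OF g0e] by (simp add: compose_eq)
      ultimately show "?g \<in> near_isometries \<and> gram ?g = gram g0"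
        using g0 by (auto simp: near_isometries_def gram_def lower_def)
    qed
    show "(\<lambda>g. compose (carrier V) g k) ` {g \<in> near_isometries. gram g = gram g0} \<subseteq> isometries"
    proof clarify
      fix g assume g: "g \<in> near_isometries" and eq: "gram g = gram g0"
      have ge: "g \<in> endo" using g by (simp add: near_isometries_def)
      have "bij_betw (compose (carrier V) g k) (carrier V) (carrier V)"
        using g by (intro bij_betw_compose[OF k(4)]) (simp add: near_isometries_def)
      moreover have "h (compose (carrier V) g k v) (compose (carrier V) g k w) = h v w"
        if vw: "v \<in> carrier V" "w \<in> carrier V" for v w
        using form_eq_if_gram_eq[OF ge g0e eq kc[OF vw(1)] kc[OF vw(2)]] vw
        by (simp add: compose_eq k(2))
      ultimately show "compose (carrier V) g k \<in> isometries"
        using compose_endo[OF ge k(1)] by (simp add: isometries_def)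
    qed
  qed
  then show ?thesis by (rule bij_betw_same_card[symmetric])
qed

end

context hermitian_module
begin

text \<open>On the diagonal, the fixed points in a coset \<open>\<rr> + x\<close> with \<open>x\<close> fixed are a translate of the fixed
  points in \<open>\<rr>\<close>, that is, of \<open>\<mm>\<close>.\<close>

lemma card_gram_range:
  "card gram_range
    = card (jacobson_radical (fixed_ring A star)) ^ m * card JA ^ (m * (m - 1) div 2)"
proof -
  let ?a = "card (jacobson_radical (fixed_ring A star))" and ?b = "card JA"
  have off: "card (JA +>\<^bsub>A\<^esub> x) = ?b" if "x \<in> carrier A" for x
    using that by (intro A.a_card_cosets_equal A.a_rcosetsI J.a_subset finite_carrier)
  have diag: "card (fixed \<inter> (JA +>\<^bsub>A\<^esub> x)) = ?a" if x: "x \<in> fixed" for x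
  proof -
    have xc: "x \<in> carrier A" using x by (rule fixed_carrier)
    have "bij_betw (\<lambda>y. y \<oplus>\<^bsub>A\<^esub> x) (fixed \<inter> JA) (fixed \<inter> (JA +>\<^bsub>A\<^esub> x))"
    proof (rule bij_betw_byWitness[where f' = "\<lambda>y. y \<ominus>\<^bsub>A\<^esub> x"])
      show "\<forall>y\<in>fixed \<inter> JA. y \<oplus>\<^bsub>A\<^esub> x \<ominus>\<^bsub>A\<^esub> x = y"
        using xc fixed_carrier by (auto simp: a_minus_def A.a_assoc A.r_neg)
      show "\<forall>y\<in>fixed \<inter> (JA +>\<^bsub>A\<^esub> x). y \<ominus>\<^bsub>A\<^esub> x \<oplus>\<^bsub>A\<^esub> x = y"
        using xc fixed_carrier by (auto simp: a_minus_def A.a_assoc A.l_neg)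
      show "(\<lambda>y. y \<oplus>\<^bsub>A\<^esub> x) ` (fixed \<inter> JA) \<subseteq> fixed \<inter> (JA +>\<^bsub>A\<^esub> x)"
        using x by (auto simp: a_r_coset_def' fixed_points_def star_add)
      show "(\<lambda>y. y \<ominus>\<^bsub>A\<^esub> x) ` (fixed \<inter> (JA +>\<^bsub>A\<^esub> x)) \<subseteq> fixed \<inter> JA"
      proof clarify
        fix y assume y: "y \<in> fixed" "y \<in> JA +>\<^bsub>A\<^esub> x"
        then obtain j where "j \<in> JA" "y = j \<oplus>\<^bsub>A\<^esub> x" by (auto simp: a_r_coset_def')
        then have "y \<ominus>\<^bsub>A\<^esub> x \<in> JA" using xc by (simp add: a_minus_def A.a_assoc A.r_neg)
        moreover have "y \<ominus>\<^bsub>A\<^esub> x \<in> fixed"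
          using x y by (simp add: a_minus_def fixed_points_def star_add star_minus)
        ultimately show "y \<ominus>\<^bsub>A\<^esub> x \<in> fixed \<inter> JA" by simp
      qed
    qed
    then show ?thesis by (metis jacobson_radical_fixed bij_betw_same_card)
  qed
  have hf: "h (e i) (e i) \<in> fixed" if "i < m" for i
    using that h_star[of "e i" "e i"] by (simp add: fixed_points_def)
  have "card gram_range = (\<Prod>(i, j)\<in>lower. if i = j then ?a else ?b)"
    unfolding gram_range_def
    by (subst card_PiE) (auto simp: lower_def diag off hf intro!: prod.cong)
  also have "\<dots> = (\<Prod>i<m. \<Prod>j\<le>i. if i = j then ?a else ?b)"
    unfolding lower_def by (rule prod.Sigma[symmetric]) auto
  also have "\<dots> = (\<Prod>i<m. ?a * ?b ^ i)"
  proof (intro prod.cong refl)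
    fix i :: nat
    have "(\<Prod>j\<le>i. if i = j then ?a else ?b) = ?a * (\<Prod>j<i. if i = j then ?a else ?b)"
      by (simp add: lessThan_Suc_atMost[symmetric])
    also have "(\<Prod>j<i. if i = j then ?a else ?b) = (\<Prod>j<i. ?b)" by (intro prod.cong) auto
    finally show "(\<Prod>j\<le>i. if i = j then ?a else ?b) = ?a * ?b ^ i" by simp
  qed
  also have "\<dots> = ?a ^ m * ?b ^ (\<Sum>i<m. i)" by (simp add: prod.distrib power_sum)
  also have "(\<Sum>i<m. i) = m * (m - 1) div 2" using Sum_Ico_nat[of 0 m] by (simp add: lessThan_atLeast0)
  finally show ?thesis .
qed

section \<open>Prescribing the Gram matrix\<close>

lemma functional_represented:
  assumes a: "a \<in> {..<m} \<rightarrow> carrier A"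
  obtains y where "y \<in> carrier V" "\<And>i. i < m \<Longrightarrow> h y (e i) = a i"
proof -
  let ?W = "regular_rmodule A"
  have reg: "right_module A ?W"
    by (rule right_module_regular) (rule A.ring_axioms)
  have a': "a \<in> {..<m} \<rightarrow> carrier ?W" using a by (simp add: regular_rmodule_def)
  have "lin_ext ?W a \<in> carrier (dual_rmodule A star V)"
    using lin_ext_hom[OF reg a'] lin_ext_extensional by (simp add: dual_rmodule_def)
  then obtain y where y: "y \<in> carrier V" "lin_ext ?W a = (\<lambda>v\<in>carrier V. h y v)"
    using nondegenerate unfolding nondegenerate_def rmodule_iso_def bij_betw_def by blast
  have "h y (e i) = a i" if "i < m" for i
    using lin_ext_basis[OF reg a' that] fun_cong[OF y(2), of "e i"] that by simp
  with y(1) show ?thesis by (rule that)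
qed

lemma h_ideal_if_basis:
  assumes u: "u \<in> carrier V" and eJ: "\<And>i. i < m \<Longrightarrow> h u (e i) \<in> JA" and w: "w \<in> carrier V"
  shows "h u w \<in> JA"
proof (rule basis_induct[OF w])
  have "h u (\<zero>\<^bsub>V\<^esub> \<odot>\<^sub>r\<^bsub>V\<^esub> \<zero>\<^bsub>A\<^esub>) = \<zero>\<^bsub>A\<^esub>"
    using u by (simp only: h_rsmult[OF u V.zero_closed A.zero_closed]) simp
  then show "h u \<zero>\<^bsub>V\<^esub> \<in> JA" by simp
  show "h u (v \<odot>\<^sub>r\<^bsub>V\<^esub> a) \<in> JA" if "v \<in> carrier V" "a \<in> carrier A" "h u v \<in> JA" for v a
    using that J.I_r_closed by (simp add: h_rsmult u)
qed (simp_all add: eJ h_add_right u)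

text \<open>By non-degeneracy each coordinate functional is \<open>h d\<close> for some \<open>d\<close>, and so the coordinates of \<open>u\<close>
  are values of the form with \<open>u\<close> as one argument.\<close>

lemma mem_N_if_h_basis:
  assumes u: "u \<in> carrier V" and eJ: "\<And>i. i < m \<Longrightarrow> h u (e i) \<in> JA"
  shows "u \<in> N"
  unfolding ideal_multiple_iff_coord[OF ideal_I u]
proof (intro allI impI)
  fix k assume k: "k < m"
  obtain d where d: "d \<in> carrier V" "\<And>i. i < m \<Longrightarrow> h d (e i) = coord (e i) k"
    by (rule functional_represented[of "\<lambda>i. coord (e i) k"]) (simp_all add: k)
  have "h d v = coord v k" if v: "v \<in> carrier V" for v
  proof -
    have h_hom: "(\<lambda>v. h d v) \<in> rmodule_hom A V (regular_rmodule A)"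
      using d by (auto simp: rmodule_hom_def regular_rmodule_def h_add_right h_rsmult)
    have coord_hom: "(\<lambda>v. coord v k) \<in> rmodule_hom A V (regular_rmodule A)"
      using k by (auto simp: rmodule_hom_def regular_rmodule_def coord_add coord_rsmult)
    show ?thesis
      by (rule rmodule_hom_eqI[OF right_module_regular[OF A.ring_axioms] h_hom coord_hom d(2) v])
  qed
  then have "coord u k = star (h u d)" using h_star[of u d] u d by simp
  then show "coord u k \<in> JA" using h_ideal_if_basis[OF u eJ d(1)] by simp
qed

text \<open>The kernel of the reduction of automorphisms; bijectivity of its members is automatic by
  Nakayama's lemma.\<close>

definition congruence_group :: "('v \<Rightarrow> 'v) set" where
  "congruence_group = {g \<in> endo. red g = (\<lambda>C\<in>carrier Vbar. C)}"

lemma id_bar: "(\<lambda>C\<in>carrier Vbar. C) \<in> endo_bar"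
proof -
  have "red (\<lambda>v\<in>carrier V. v) = (\<lambda>C\<in>carrier Vbar. C)"
  proof (rule extensionalityI[of _ "carrier Vbar"])
    fix C assume "C \<in> carrier Vbar"
    then obtain v where "v \<in> carrier V" "C = N +>\<^bsub>V\<^esub> v" by (auto simp: carrier_Vbar)
    then show "red (\<lambda>v\<in>carrier V. v) C = (\<lambda>C\<in>carrier Vbar. C) C"
      using red_coset[OF id_endo, of v] by (simp add: carrier_Vbar)
  qed (simp_all add: red_def)
  then show ?thesis using red_endo_bar[OF id_endo] by simp
qed

lemma congruence_group_iff:
  "g \<in> congruence_group \<longleftrightarrow> g \<in> endo \<and> (\<forall>v\<in>carrier V. N +>\<^bsub>V\<^esub> g v = N +>\<^bsub>V\<^esub> v)"
proof (cases "g \<in> endo")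
  case True
  have "red g = (\<lambda>C\<in>carrier Vbar. C) \<longleftrightarrow> (\<forall>v\<in>carrier V. N +>\<^bsub>V\<^esub> g v = N +>\<^bsub>V\<^esub> v)"
  proof
    assume r: "red g = (\<lambda>C\<in>carrier Vbar. C)"
    show "\<forall>v\<in>carrier V. N +>\<^bsub>V\<^esub> g v = N +>\<^bsub>V\<^esub> v"
    proof
      fix v assume v: "v \<in> carrier V"
      have "N +>\<^bsub>V\<^esub> v \<in> carrier Vbar" using v by (simp add: carrier_Vbar)
      then show "N +>\<^bsub>V\<^esub> g v = N +>\<^bsub>V\<^esub> v" using red_coset[OF True v] by (simp add: r)
    qed
  next
    assume *: "\<forall>v\<in>carrier V. N +>\<^bsub>V\<^esub> g v = N +>\<^bsub>V\<^esub> v"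
    show "red g = (\<lambda>C\<in>carrier Vbar. C)"
      by (rule endo_bar_eqI[OF red_endo_bar[OF True] id_bar]) 
        (simp add: red_coset[OF True] * carrier_Vbar)
  qed
  then show ?thesis using True by (simp add: congruence_group_def)
qed (simp add: congruence_group_def)

lemma congruence_group_bij:
  assumes g: "g \<in> congruence_group" shows "bij_betw g (carrier V) (carrier V)"
proof -
  have ge: "g \<in> endo" and r: "red g = (\<lambda>C\<in>carrier Vbar. C)" using g by (auto simp: congruence_group_def)
  have "bij_betw (red g) (carrier Vbar) (carrier Vbar)"
    by (simp add: r bij_betw_def inj_on_def)
  then show ?thesis using red_bij_iff[OF finite_ring_axioms refl ge] by simp
qed

lemma congruence_group_near_isometries:
  assumes g: "g \<in> congruence_group" shows "g \<in> near_isometries"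
proof -
  have ge: "g \<in> endo" and gN: "\<And>v. v \<in> carrier V \<Longrightarrow> N +>\<^bsub>V\<^esub> g v = N +>\<^bsub>V\<^esub> v"
    using g by (auto simp: congruence_group_iff)
  have "JA +>\<^bsub>A\<^esub> h (g v) (g w) = JA +>\<^bsub>A\<^esub> h v w" if "v \<in> carrier V" "w \<in> carrier V" for v w
    using that endoD(1)[OF ge] by (simp add: gN flip: reduced_form_coset_JA)
  then show ?thesis using congruence_group_bij[OF g] ge by (simp add: near_isometries_def)
qed

lemma odd_card_congruence_group: "odd (card congruence_group)"
  unfolding congruence_group_def
  using card_red_fibre[OF id_bar] card_ideal_multiple[OF ideal_I] odd_card_jacobson_radical
  by simp

lemma congruence_group_subgroup: "subgroup congruence_group (BijGroup (carrier V))"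
proof -
  interpret B: group "BijGroup (carrier V)" by (rule group_BijGroup)
  have Bij: "g \<in> Bij (carrier V)" if "g \<in> congruence_group" for g
    using that congruence_group_bij by (auto simp: Bij_def congruence_group_def endo_def)
  show ?thesis
  proof (rule B.subgroupI)
    show "congruence_group \<subseteq> carrier (BijGroup (carrier V))"
      using Bij by (auto simp: BijGroup_def)
    have "(\<lambda>v\<in>carrier V. v) \<in> congruence_group" using id_endo by (simp add: congruence_group_iff)
    then show "congruence_group \<noteq> {}" by blast
    fix g assume g: "g \<in> congruence_group"
    have ge: "g \<in> endo" and gN: "\<And>v. v \<in> carrier V \<Longrightarrow> N +>\<^bsub>V\<^esub> g v = N +>\<^bsub>V\<^esub> v"
      using g by (auto simp: congruence_group_iff)
    note k = inverse_endo[OF ge congruence_group_bij[OF g] refl]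
    let ?k = "\<lambda>v\<in>carrier V. inv_into (carrier V) g v"
    have "N +>\<^bsub>V\<^esub> ?k v = N +>\<^bsub>V\<^esub> v" if v: "v \<in> carrier V" for v
      using gN[OF endoD(1)[OF k(1) v]] by (simp only: k(2)[OF v])
    then show "inv\<^bsub>BijGroup (carrier V)\<^esub> g \<in> congruence_group"
      unfolding inv_BijGroup[OF Bij[OF g]] using k(1) by (simp only: congruence_group_iff) simp
    fix f assume f: "f \<in> congruence_group"
    have fe: "f \<in> endo" and fN: "\<And>v. v \<in> carrier V \<Longrightarrow> N +>\<^bsub>V\<^esub> f v = N +>\<^bsub>V\<^esub> v"
      using f by (auto simp: congruence_group_iff)
    have "compose (carrier V) g f \<in> congruence_group"
      using compose_endo[OF ge fe] by (simp add: congruence_group_iff compose_eq gN fN endoD(1)[OF fe])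
    then show "g \<otimes>\<^bsub>BijGroup (carrier V)\<^esub> f \<in> congruence_group"
      using Bij f g by (simp add: BijGroup_def)
  qed
qed

text \<open>In a group of odd order \<open>2l + 1\<close> the power \<open>X = Y\<^sup>l\<^sup>+\<^sup>1\<close> satisfies \<open>X\<^sup>2 = Y\<close>. Powers of a
  self-adjoint map are self-adjoint, so \<open>h (X v) (X w) = h v (X (X w)) = h v (Y w)\<close>.\<close>

lemma self_adjoint_square_root:
  assumes Y: "Y \<in> congruence_group"
    and adj: "\<And>v w. v \<in> carrier V \<Longrightarrow> w \<in> carrier V \<Longrightarrow> h (Y v) w = h v (Y w)"
  obtains X where "X \<in> congruence_group"
    "\<And>v w. v \<in> carrier V \<Longrightarrow> w \<in> carrier V \<Longrightarrow> h (X v) (X w) = h (Y v) w"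
proof -
  let ?G = "BijGroup (carrier V)\<lparr>carrier := congruence_group\<rparr>"
  interpret G: group ?G
    by (rule subgroup.subgroup_is_group[OF congruence_group_subgroup group_BijGroup])
  have mult: "f \<otimes>\<^bsub>?G\<^esub> g = compose (carrier V) f g"
    if "f \<in> congruence_group" "g \<in> congruence_group" for f g
    using that subgroup.subset[OF congruence_group_subgroup] by (auto simp: BijGroup_def)
  have YG: "Y \<in> carrier ?G" using Y by simp
  obtain l where l: "card congruence_group = 2 * l + 1"
    using odd_card_congruence_group by (rule oddE)
  define k where "k = l + 1"
  have k: "order ?G + 1 = k + k" by (simp add: order_def l k_def)
  define X where "X = Y [^]\<^bsub>?G\<^esub> k"
  have pow: "Y [^]\<^bsub>?G\<^esub> n \<in> congruence_group" for n :: nat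
    using G.nat_pow_closed[OF YG, of n] by simp
  have pow_closed: "(Y [^]\<^bsub>?G\<^esub> n) v \<in> carrier V" if "v \<in> carrier V" for n :: nat and v
    using pow[of n] that by (auto simp: congruence_group_def endoD)
  have adj_pow: "h ((Y [^]\<^bsub>?G\<^esub> n) v) w = h v ((Y [^]\<^bsub>?G\<^esub> n) w)"
    if "v \<in> carrier V" "w \<in> carrier V" for n :: nat and v w
    using that
  proof (induction n arbitrary: v w)
    case 0
    then show ?case by (simp add: BijGroup_def)
  next
    case (Suc n)
    have 1: "(Y [^]\<^bsub>?G\<^esub> Suc n) v = (Y [^]\<^bsub>?G\<^esub> n) (Y v)"
      using Suc.prems by (simp only: G.nat_pow_Suc mult[OF pow Y] compose_eq)
    have 2: "(Y [^]\<^bsub>?G\<^esub> Suc n) w = Y ((Y [^]\<^bsub>?G\<^esub> n) w)"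
      using Suc.prems by (simp only: G.nat_pow_Suc2[OF YG] mult[OF Y pow] compose_eq)
    have Yv: "Y v \<in> carrier V" using Y Suc.prems by (auto simp: congruence_group_def endoD)
    show ?case
      unfolding 1 2 Suc.IH[OF Yv Suc.prems(2)]
      by (rule adj[OF Suc.prems(1) pow_closed[OF Suc.prems(2)]])
  qed
  have "X \<otimes>\<^bsub>?G\<^esub> X = Y [^]\<^bsub>?G\<^esub> (order ?G + 1)"
    unfolding X_def k by (rule G.nat_pow_mult[OF YG])
  also have "\<dots> = Y" using G.pow_order_eq_1[OF YG] G.l_one[OF YG] by simp
  finally have XX: "compose (carrier V) X X = Y"
    using mult[OF pow pow] by (simp add: X_def)
  have "h (X v) (X w) = h (Y v) w" if vw: "v \<in> carrier V" "w \<in> carrier V" for v w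
  proof -
    have "h (X v) (X w) = h v (X (X w))"
      unfolding X_def by (rule adj_pow[OF vw(1) pow_closed[OF vw(2)]])
    also have "X (X w) = Y w" using vw(2) by (simp flip: XX add: compose_eq)
    finally show ?thesis using adj[OF vw] by simp
  qed
  moreover have "X \<in> congruence_group" unfolding X_def by (rule pow)
  ultimately show ?thesis by (rule that[rotated])
qed

text \<open>Non-degeneracy turns the rows of the prescribed matrix \<open>M\<close> into vectors \<open>y\<^sub>j\<close> with \<open>h y\<^sub>j e\<^sub>i = M\<^sub>j\<^sub>i\<close>. The map
  \<open>Y\<close> sending \<open>e\<^sub>j\<close> to \<open>y\<^sub>j\<close> is self-adjoint since \<open>M\<close> is hermitian, and congruent to the identity
  since \<open>M\<close> is congruent to the Gram matrix of \<open>h\<close>. Its square root has Gram matrix \<open>M\<close>.\<close>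

lemma gram_surj:
  assumes B: "B \<in> gram_range"
  obtains g where "g \<in> near_isometries" "gram g = B"
proof -
  have Bext: "B \<in> extensional lower" using B by (simp add: gram_range_def PiE_def)
  define M where "M i j = (if j \<le> i then B (i, j) else star (B (j, i)))" for i j
  have B1: "B (i, j) \<in> JA +>\<^bsub>A\<^esub> h (e i) (e j)" "i = j \<Longrightarrow> star (B (i, j)) = B (i, j)"
    if "j \<le> i" "i < m" for i j
  proof -
    have ij: "(i, j) \<in> lower" using that by (simp add: lower_def)
    have "B (i, j) \<in> (if i = j then fixed \<inter> (JA +>\<^bsub>A\<^esub> h (e i) (e j)) else JA +>\<^bsub>A\<^esub> h (e i) (e j))"
      using PiE_mem[OF B[unfolded gram_range_def] ij] by (simp only: prod.case)
    then show "B (i, j) \<in> JA +>\<^bsub>A\<^esub> h (e i) (e j)" "i = j \<Longrightarrow> star (B (i, j)) = B (i, j)"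
      by (auto simp: fixed_points_def split: if_splits)
  qed
  have M1: "\<exists>x\<in>JA. M i j = x \<oplus>\<^bsub>A\<^esub> h (e i) (e j)" if ij: "i < m" "j < m" for i j
  proof (cases "j \<le> i")
    case True
    then show ?thesis using B1(1)[OF True ij(1)] by (auto simp: M_def a_r_coset_def')
  next
    case False
    then obtain x where x: "x \<in> JA" "B (j, i) = x \<oplus>\<^bsub>A\<^esub> h (e j) (e i)"
      using B1(1)[of i j] ij by (auto simp: a_r_coset_def')
    have "star (B (j, i)) = star x \<oplus>\<^bsub>A\<^esub> h (e i) (e j)"
      using x ij by (simp add: star_add J.a_Hcarr h_star[of "e j" "e i"])
    then show ?thesis using False x(1) by (auto simp: M_def)
  qed
  have Mc: "M i j \<in> carrier A" if "i < m" "j < m" for i j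
    using M1[OF that] that by auto
  have Mstar: "star (M i j) = M j i" if "i < m" "j < m" for i j
  proof (cases i j rule: linorder_cases)
    case less
    have "B (j, i) \<in> carrier A" using Mc[OF that(2,1)] less by (simp add: M_def)
    then show ?thesis using less by (simp add: M_def)
  next
    case equal
    then show ?thesis using B1(2)[of j i] that by (simp add: M_def)
  next
    case greater
    then show ?thesis by (simp add: M_def)
  qed
  have "\<exists>y\<in>carrier V. \<forall>i<m. h y (e i) = M j i" if j: "j < m" for j
    by (rule functional_represented[of "M j"]) (auto simp: Mc[OF j])
  then have "\<forall>j\<in>{..<m}. \<exists>y. y \<in> carrier V \<and> (\<forall>i<m. h y (e i) = M j i)" by blast
  then obtain y where "\<forall>j\<in>{..<m}. y j \<in> carrier V \<and> (\<forall>i<m. h (y j) (e i) = M j i)"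
    by (rule bchoice[THEN exE])
  then have y: "\<And>j. j < m \<Longrightarrow> y j \<in> carrier V"
    and hy: "\<And>i j. i < m \<Longrightarrow> j < m \<Longrightarrow> h (y j) (e i) = M j i"
    by simp_all
  define Y where "Y = lin_ext V y"
  have y': "y \<in> {..<m} \<rightarrow> carrier V" using y by auto
  have Ye: "Y \<in> endo"
    unfolding Y_def endo_def using lin_ext_hom[OF right_module_axioms y'] lin_ext_extensional by simp
  have Yb: "Y (e j) = y j" if "j < m" for j
    unfolding Y_def by (rule lin_ext_basis[OF right_module_axioms y' that])
  have YG: "Y \<in> congruence_group"
    unfolding congruence_group_def
  proof (intro CollectI conjI Ye red_eqI[OF Ye id_bar])
    fix j assume j: "j < m"
    (* u is y j - e j; writing the minus sign as a scalar makes the form's linearity applicable. *)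
    define u where "u = y j \<oplus>\<^bsub>V\<^esub> e j \<odot>\<^sub>r\<^bsub>V\<^esub> (\<ominus>\<^bsub>A\<^esub> \<one>\<^bsub>A\<^esub>)"
    have u: "u \<in> carrier V" using j y by (simp add: u_def)
    have "h u (e i) \<in> JA" if i: "i < m" for i
    proof -
      obtain x where x: "x \<in> JA" "M j i = x \<oplus>\<^bsub>A\<^esub> h (e j) (e i)" using M1[OF j i] by blast
      have "h (e j \<odot>\<^sub>r\<^bsub>V\<^esub> (\<ominus>\<^bsub>A\<^esub> \<one>\<^bsub>A\<^esub>)) (e i) = star (h (e i) (e j) \<otimes>\<^bsub>A\<^esub> (\<ominus>\<^bsub>A\<^esub> \<one>\<^bsub>A\<^esub>))"
        using i j h_star[of "e i" "e j \<odot>\<^sub>r\<^bsub>V\<^esub> (\<ominus>\<^bsub>A\<^esub> \<one>\<^bsub>A\<^esub>)"] by (simp add: h_rsmult del: A.r_minus)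
      also have "\<dots> = \<ominus>\<^bsub>A\<^esub> h (e j) (e i)"
        using i j h_star[of "e i" "e j"] by (simp add: A.r_minus star_minus)
      finally have "h u (e i) = M j i \<oplus>\<^bsub>A\<^esub> \<ominus>\<^bsub>A\<^esub> h (e j) (e i)"
        unfolding u_def using i j y hy by (simp add: h_add_left)
      also have "\<dots> = x" using x i j by (simp add: A.a_assoc A.r_neg J.a_Hcarr)
      finally show ?thesis using x(1) by simp
    qed
    then have "u \<in> N" using mem_N_if_h_basis[OF u] by blast
    moreover have "y j = e j \<oplus>\<^bsub>V\<^esub> u"
      unfolding u_def rsmult_minus_one[OF e_closed[OF j]]
      using j y V.a_lcomm[of "e j" "y j" "\<ominus>\<^bsub>V\<^esub> e j"] by (simp add: V.r_neg)
    ultimately have "N +>\<^bsub>V\<^esub> Y (e j) = N +>\<^bsub>V\<^esub> e j"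
      unfolding Yb[OF j] using coset_eq_iff[OF y[OF j] e_closed[OF j]] by blast
    then show "N +>\<^bsub>V\<^esub> Y (e j) = (\<lambda>C\<in>carrier Vbar. C) (N +>\<^bsub>V\<^esub> e j)"
      using j by (simp add: carrier_Vbar)
  qed
  have adj: "h (Y v) w = h v (Y w)" if vw: "v \<in> carrier V" "w \<in> carrier V" for v w
  proof -
    have "h (Y v) ((\<lambda>v\<in>carrier V. v) w) = h ((\<lambda>v\<in>carrier V. v) v) (Y w)"
    proof (rule form_eq_if_eq_on_basis[OF Ye id_endo id_endo Ye _ vw])
      fix i j assume ij: "i < m" "j < m"
      have "h (e i) (y j) = star (M j i)"
        using ij y hy h_star[of "y j" "e i"] by simp
      then show "h (Y (e i)) ((\<lambda>v\<in>carrier V. v) (e j)) = h ((\<lambda>v\<in>carrier V. v) (e i)) (Y (e j))"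
        using ij by (simp add: Yb hy Mstar)
    qed
    then show ?thesis using vw by simp
  qed
  obtain X where X: "X \<in> congruence_group"
    "\<And>v w. v \<in> carrier V \<Longrightarrow> w \<in> carrier V \<Longrightarrow> h (X v) (X w) = h (Y v) w"
    using self_adjoint_square_root[OF YG adj] by blast
  have "gram X = B"
  proof (rule extensionalityI[of _ lower])
    show "gram X \<in> extensional lower" by (simp add: gram_def)
    fix p assume "p \<in> lower"
    then obtain i j where p: "p = (i, j)" "(i, j) \<in> lower" "j \<le> i" "i < m" by (auto simp: lower_def)
    then show "gram X p = B p"
      using X(2)[of "e i" "e j"] by (simp add: gram_def Yb hy M_def)
  qed (rule Bext)
  with congruence_group_near_isometries[OF X(1)] show ?thesis by (rule that)
qed

section \<open>The order of the unitary group\<close>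

lemma card_near_isometries_by_gram:
  "card near_isometries = card gram_range * card isometries"
proof (rule card_eq_mult_card_fibre[where f = gram])
  show "finite near_isometries"
    using finite_endo by (rule rev_finite_subset) (auto simp: near_isometries_def)
  have "finite (JA +>\<^bsub>A\<^esub> x)" if "x \<in> carrier A" for x
    using finite_subset[OF A.a_r_coset_subset_G[OF J.a_subset that] finite_carrier] .
  then show "finite gram_range"
    unfolding gram_range_def by (intro finite_PiE) (auto simp: lower_def)
  show "gram \<in> near_isometries \<rightarrow> gram_range" using gram_mem_range by auto
  fix B assume "B \<in> gram_range"
  then obtain g where "g \<in> near_isometries" "gram g = B" by (rule gram_surj)
  then show "card {g \<in> near_isometries. gram g = B} = card isometries"
    using card_gram_fibre by auto
qed

text \<open>Equating the two counts, the exponent \<open>m\<^sup>2 = m(m-1)/2 + m(m-1)/2 + m\<close> of \<open>|\<rr>|\<close> splits so that one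
  factor and \<open>|\<mm>|\<^sup>m\<close> cancel.\<close>

lemma order_unitary_group_reduction:
  "order (unitary_group A V h)
    = card JA ^ (m * (m - 1) div 2) * card (trace_kernel A star) ^ m * order Ubar"
proof -
  let ?a = "card (jacobson_radical (fixed_ring A star))" and ?s = "card (trace_kernel A star)"
    and ?b = "card JA" and ?t = "m * (m - 1) div 2"
  have "even (m * (m - 1))" by (cases m) auto
  then have "m * (m - 1) = ?t + ?t" by presburger
  moreover have "m * m = m * (m - 1) + m" by (cases m) simp_all
  ultimately have t: "m * m = ?t + ?t + m" by simp
  have b: "?b = ?a * ?s" by (rule card_jacobson_radical)
  have "?b \<noteq> 0" using odd_card_jacobson_radical by (intro notI) simp
  then have nz: "?a ^ m * ?b ^ ?t \<noteq> 0" using b by auto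
  have "?a ^ m * ?b ^ ?t * card isometries = order Ubar * (?b ^ m) ^ m"
    using card_near_isometries_by_gram card_near_isometries_by_reduction
    by (simp add: card_gram_range card_ideal_multiple[OF ideal_I])
  also have "(?b ^ m) ^ m = ?b ^ ?t * ?b ^ ?t * ?b ^ m"
    by (simp only: power_mult[symmetric] t power_add)
  also have "?b ^ m = ?a ^ m * ?s ^ m" by (simp add: b power_mult_distrib)
  finally have "(?a ^ m * ?b ^ ?t) * card isometries = (?a ^ m * ?b ^ ?t) * (?b ^ ?t * ?s ^ m * order Ubar)"
    by (simp only: mult_ac)
  then show ?thesis unfolding mult_left_cancel[OF nz] order_unitary_group .
qed

end

theorem theorem5p5:
  fixes A :: "('a, 'r) ring_scheme"
    and star :: "'a \<Rightarrow> 'a"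
    and V :: "('a, 'v, 's) rmodule_scheme"
    and h :: "'v \<Rightarrow> 'v \<Rightarrow> 'a"
    and m :: nat
  assumes "local_ring A"
    and "finite (carrier A)"
    and "ring_involution A star"
    and "fixed_points A star \<subseteq> ring_center A"
    and "odd (ring_characteristic
          (fixed_ring A star Quot jacobson_radical (fixed_ring A star)))"
    and "right_module A V"
    and "free_of_rank A V m"
    and "m \<ge> 1"
    and "hermitian_form A star V h"
    and "nondegenerate A star V h"
  shows "let \<rr> = jacobson_radical A;
             \<mm> = jacobson_radical (fixed_ring A star);
             \<ss> = trace_kernel A star;
             U = unitary_group A V h;
             U' = unitary_group (A Quot \<rr>) (reduced_rmodule V \<rr>) (reduced_form A \<rr> h)
         in order U = card \<rr> ^ (m * (m - 1) div 2) * card \<ss> ^ m * order U' \<and>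
            real (order U) =
              real (card \<rr> ^ (m * (m + 1) div 2) * order U') / real (card \<mm> ^ m)"
proof -
  obtain e where e: "e \<in> {..<m} \<rightarrow> carrier V"
    "\<forall>v\<in>carrier V. \<exists>!c. c \<in> {..<m} \<rightarrow>\<^sub>E carrier A \<and>
      v = finsum V (\<lambda>i. e i \<odot>\<^sub>r\<^bsub>V\<^esub> c i) {..<m}"
    using assms(7) unfolding free_of_rank_def by (elim bexE)
  have "ring A" using assms(1) by (simp add: local_ring_def)
  then interpret A: involutive_local_ring A star
    using assms by (intro involutive_local_ring.intro finite_local_ring.intro finite_ring.intro
      finite_ring_axioms.intro finite_local_ring_axioms.intro involutive_local_ring_axioms.intro)
  interpret hermitian_module A V star e m h
    using assms e(1) bspec[OF e(2)] A.involutive_local_ring_axioms A.jacobson_radical_ideal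
    by (intro hermitian_module.intro free_module_with_ideal.intro free_module.intro
      module_with_ideal.intro free_module_axioms.intro hermitian_module_axioms.intro)
  let ?r = "card (jacobson_radical A)" and ?m = "card (jacobson_radical (fixed_ring A star))"
    and ?s = "card (trace_kernel A star)"
  have r: "?r = ?m * ?s" by (rule A.card_jacobson_radical)
  have "?r \<noteq> 0" using A.odd_card_jacobson_radical by (intro notI) simp
  then have "?m \<noteq> 0" using r by auto
  have "m * (m + 1) div 2 = m * (m - 1) div 2 + m"
    by (cases m) (simp_all add: algebra_simps)
  then have "?r ^ (m * (m + 1) div 2) = ?r ^ (m * (m - 1) div 2) * ?s ^ m * ?m ^ m"
    by (simp add: power_add) (simp add: r power_mult_distrib)
  then have "real (?r ^ (m * (m + 1) div 2) * k) / real (?m ^ m) = real (?r ^ (m * (m - 1) div 2) * ?s ^ m * k)" for k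
    using \<open>?m \<noteq> 0\<close> by simp
  then show ?thesis
    unfolding Let_def order_unitary_group_reduction by simp
qed

end
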